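(* Let $\overline m>0$ and consider the non-disordered harmonic chain of size $N$ in which all masses are equal, $m_x=\overline m$ for all $x$ (as described in the context). Let $T>0$, $t\in[0,T]$, $f\in\mathcal C^0([0,1])$. Assume the chain is initially prepared in the local Gibbs state with parameters $\beta,\mathsf r,\mathsf p$, where $\beta>0$ is constant (thermal equilibrium), $\mathsf r\in\mathcal C^1([0,1])$ with $\mathsf r(0)=\mathsf r(1)=0$, and $\mathsf p\in\mathcal C^1([0,1])$. Let $(\mathbf r,\mathbf p,\mathbf e)$ be the solution on $[0,1]\times[0,T]$ of $$\partial_t \mathbf r=\frac1{\overline m}\,\partial_y\mathbf p,\quad \mathbf r(0,t)=\mathbf r(1,t)=0,\qquad \partial_t\mathbf p=\partial_y\mathbf r,\qquad \partial_t\mathbf e=\frac1{\overline m}\,\partial_y(\mathbf r\,\mathbf p),$$ with initial data $\mathbf r(y,0)=\mathsf r(y)$, $\mathbf p(y,0)=\mathsf p(y)$, $\mathbf e(y,0)=\frac1{\beta}+\frac{\mathsf p(y)^2}{2\overline m}+\frac{\mathsf r(y)^2}{2}$. Then, as $N\to\infty$, $$\frac1N\sum_{x=1}^N f(x/N)\,\langle\!\langle r_x(Nt)\rangle\!\rangle\to\int_0^1\mathbf r(y,t)f(y)\,dy,\qquad \frac1N\sum_{x=1}^N f(x/N)\,\langle\!\langle p_x(Nt)\rangle\!\rangle\to\int_0^1\mathbf p(y,t)f(y)\,dy,$$ $$\frac1N\sum_{x=1}^N f(x/N)\,\langle\!\langle e_x(Nt)\rangle\!\rangle\to\int_0^1\mathbf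 e(y,t)f(y)\,dy.$$
   Context: **Dynamics.** The chain of size $N$ with masses $m_1,\dots,m_N>0$ has phase space variables $r=(r_1,\dots,r_{N-1})\in\mathbb R^{N-1}$ and $p=(p_1,\dots,p_N)\in\mathbb R^N$, with the convention $r_0=r_N=0$. The (deterministic, linear) equations of motion are $$\dot r_x=\frac{p_{x+1}}{m_{x+1}}-\frac{p_x}{m_x}\ (1\le x\le N-1),\qquad \dot p_x=r_x-r_{x-1}\ (1\le x\le N).$$ The energy at site $x$ is $e_x=\frac{p_x^2}{2m_x}+\frac{r_x^2}{2}$ for $1\le x\le N$. **Initial state.** The initial condition $(r(0),p(0))$ is distributed according to the density on $\mathbb R^{N-1}\times\mathbb R^N$ $$\rho_{\rm loc}(r,p)=\frac1{Z_{\rm loc}}\exp\Big\{-\frac{\beta}2\sum_{x=1}^N m_x\Big(\frac{p_x}{m_x}-\frac{\mathsf p(x/N)}{\overline m}\Big)^2-\frac{\beta}2\sum_{x=1}^{N-1}\big(r_x-\mathsf r(x/N)\big)^2\Big\},$$ with $Z_{\rm loc}$ the normalizing constant. $\langle\!\langle\cdot\rangle\!\rangle$ denotes expectation with respect to this initial distribution; $r_x(s),p_x(s),e_x(s)$ are evaluated along the solution at time $s$ started from the random initial condition. **Meaning of the solution of the macroscopic equations.** $(\mathbf r,\mathbf p)$ is the unique solution, characterized by: for all smooth $f,g:[0,1]\to\mathbb R$ with $f(0)=f(1)=0$ and all $t$, $$\int_0^1\mathbf r(y,t)f(y)dy=\int_0^1\mathsf r f\,dy-\frac1{\overline m}\int_0^t\!\int_0^1\mathbf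 p(y,s)f'(y)\,dy\,ds,\qquad \int_0^1\mathbf p(y,t)g(y)dy=\int_0^1\mathsf p g\,dy-\int_0^t\!\int_0^1\mathbf r(y,s)g'(y)\,dy\,ds,$$ with $\mathbf r,\mathbf p$ continuous on $[0,1]\times[0,T]$. The energy equation with its initial condition then amounts to $\mathbf e(y,t)=\frac{\mathbf p(y,t)^2}{2\overline m}+\frac{\mathbf r(y,t)^2}{2}+\frac1{\beta}$. *)

theory Defs
  imports "HOL-Probability.Probability"
begin

text \<open>Regularity on the closed unit interval: derivatives are one-sided at the endpoints, so nothing
  is assumed about the function outside \<open>[0,1]\<close>. (The library's \<open>C1_differentiable_on\<close> demands
  two-sided derivatives at the endpoints.)\<close>

definition Ck_unit :: "nat \<Rightarrow> (real \<Rightarrow> real) \<Rightarrow> bool" where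
  "Ck_unit k f \<longleftrightarrow> (\<exists>D :: nat \<Rightarrow> real \<Rightarrow> real. D 0 = f \<and>
     (\<forall>j<k. \<forall>y\<in>{0..1}. (D j has_real_derivative D (Suc j) y) (at y within {0..1})) \<and>
     (\<forall>j\<le>k. continuous_on {0..1} (D j)))"

definition smooth_unit :: "(real \<Rightarrow> real) \<Rightarrow> bool" where
  "smooth_unit f \<longleftrightarrow> (\<forall>k. Ck_unit k f)"


text \<open>A phase-space point is a pair \<open>(r, p)\<close> with \<open>r\<close> indexed by \<open>{1..N-1}\<close> and \<open>p\<close> by \<open>{1..N}\<close>.\<close>

type_synonym phase_point = "(nat \<Rightarrow> real) \<times> (nat \<Rightarrow> real)"

definition phase_lborel :: "nat \<Rightarrow> phase_point measure" where
  "phase_lborel N =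
     PiM {1..N-1} (\<lambda>_. lborel :: real measure) \<Otimes>\<^sub>M PiM {1..N} (\<lambda>_. lborel :: real measure)"

text \<open>\<open>r s x\<close> and \<open>p s x\<close> are the values at time \<open>s\<close> and site \<open>x\<close>; \<open>r\<close> is extended to the sites
  \<open>0\<close> and \<open>N\<close> by the convention \<open>r\<^sub>0 = r\<^sub>N = 0\<close>.\<close>

definition chain_solution ::
    "nat \<Rightarrow> (nat \<Rightarrow> real) \<Rightarrow> phase_point \<Rightarrow> (real \<Rightarrow> nat \<Rightarrow> real) \<Rightarrow> (real \<Rightarrow> nat \<Rightarrow> real) \<Rightarrow> bool" where
  "chain_solution N m w r p \<longleftrightarrow>
     (\<forall>x\<in>{1..N-1}. r 0 x = fst w x) \<and>
     (\<forall>x\<in>{1..N}. p 0 x = snd w x) \<and>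
     (\<forall>s\<ge>0. r s 0 = 0 \<and> r s N = 0) \<and>
     (\<forall>s\<ge>0. \<forall>x\<in>{1..N-1}.
        ((\<lambda>u. r u x) has_real_derivative p s (x+1) / m (x+1) - p s x / m x) (at s within {0..})) \<and>
     (\<forall>s\<ge>0. \<forall>x\<in>{1..N}.
        ((\<lambda>u. p u x) has_real_derivative r s x - r s (x-1)) (at s within {0..}))"

definition site_energy :: "(nat \<Rightarrow> real) \<Rightarrow> (nat \<Rightarrow> real) \<Rightarrow> (nat \<Rightarrow> real) \<Rightarrow> nat \<Rightarrow> real" where
  "site_energy m r p x = (p x)\<^sup>2 / (2 * m x) + (r x)\<^sup>2 / 2"


definition gibbs_weight ::
    "nat \<Rightarrow> (nat \<Rightarrow> real) \<Rightarrow> real \<Rightarrow> real \<Rightarrow> (real \<Rightarrow> real) \<Rightarrow> (real \<Rightarrow> real) \<Rightarrow> phase_point \<Rightarrow> real" where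
  "gibbs_weight N m mbar \<beta> rini pini w = exp
     (- \<beta> / 2 * (\<Sum>x=1..N. m x * (snd w x / m x - pini (real x / real N) / mbar)\<^sup>2)
      - \<beta> / 2 * (\<Sum>x=1..N-1. (fst w x - rini (real x / real N))\<^sup>2))"

definition gibbs_Z ::
    "nat \<Rightarrow> (nat \<Rightarrow> real) \<Rightarrow> real \<Rightarrow> real \<Rightarrow> (real \<Rightarrow> real) \<Rightarrow> (real \<Rightarrow> real) \<Rightarrow> real" where
  "gibbs_Z N m mbar \<beta> rini pini = (\<integral>w. gibbs_weight N m mbar \<beta> rini pini w \<partial>phase_lborel N)"

definition local_gibbs ::
    "nat \<Rightarrow> (nat \<Rightarrow> real) \<Rightarrow> real \<Rightarrow> real \<Rightarrow> (real \<Rightarrow> real) \<Rightarrow> (real \<Rightarrow> real) \<Rightarrow> phase_point measure" where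
  "local_gibbs N m mbar \<beta> rini pini = density (phase_lborel N)
     (\<lambda>w. ennreal (gibbs_weight N m mbar \<beta> rini pini w / gibbs_Z N m mbar \<beta> rini pini))"


text \<open>The solution \<open>(r, p, e)\<close> on \<open>[0,1] \<times> [0,T]\<close>, arguments in the order space, time. The pair
  \<open>(r, p)\<close> is in general only continuous, and solves the equations in the weak sense; the boundary
  condition on \<open>r\<close> is encoded by the test functions \<open>g\<close> not having to vanish at \<open>0\<close> and \<open>1\<close>.
  The equations for \<open>r\<close> and \<open>p\<close> give \<open>\<partial>\<^sub>t (p\<^sup>2/(2 mbar) + r\<^sup>2/2) = \<partial>\<^sub>y (r p) / mbar\<close>, so the energy
  equation \<open>\<partial>\<^sub>t e = \<partial>\<^sub>y (r p) / mbar\<close> with initial value \<open>1/\<beta> + pini\<^sup>2/(2 mbar) + rini\<^sup>2/2\<close> says that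
  \<open>e - p\<^sup>2/(2 mbar) - r\<^sup>2/2\<close> keeps its initial value \<open>1/\<beta>\<close>; for merely continuous \<open>(r, p)\<close> this is
  taken as its meaning.\<close>

definition macro_solution ::
    "real \<Rightarrow> real \<Rightarrow> real \<Rightarrow> (real \<Rightarrow> real) \<Rightarrow> (real \<Rightarrow> real) \<Rightarrow>
     (real \<Rightarrow> real \<Rightarrow> real) \<Rightarrow> (real \<Rightarrow> real \<Rightarrow> real) \<Rightarrow> (real \<Rightarrow> real \<Rightarrow> real) \<Rightarrow> bool" where
  "macro_solution mbar \<beta> T rini pini r p e \<longleftrightarrow>
     continuous_on ({0..1} \<times> {0..T}) (\<lambda>(y, t). r y t) \<and>
     continuous_on ({0..1} \<times> {0..T}) (\<lambda>(y, t). p y t) \<and>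
     (\<forall>f f'. smooth_unit f \<longrightarrow> f 0 = 0 \<longrightarrow> f 1 = 0 \<longrightarrow>
        (\<forall>y\<in>{0..1}. (f has_real_derivative f' y) (at y within {0..1})) \<longrightarrow>
        (\<forall>t\<in>{0..T}. integral {0..1} (\<lambda>y. r y t * f y) =
           integral {0..1} (\<lambda>y. rini y * f y)
           - 1 / mbar * integral {0..t} (\<lambda>s. integral {0..1} (\<lambda>y. p y s * f' y)))) \<and>
     (\<forall>g g'. smooth_unit g \<longrightarrow>
        (\<forall>y\<in>{0..1}. (g has_real_derivative g' y) (at y within {0..1})) \<longrightarrow>
        (\<forall>t\<in>{0..T}. integral {0..1} (\<lambda>y. p y t * g y) =
           integral {0..1} (\<lambda>y. pini y * g y)
           - integral {0..t} (\<lambda>s. integral {0..1} (\<lambda>y. r y s * g' y)))) \<and>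
     (\<forall>y\<in>{0..1}. \<forall>t\<in>{0..T}. e y t = (p y t)\<^sup>2 / (2 * mbar) + (r y t)\<^sup>2 / 2 + 1 / \<beta>)"

end

theory Submission
  imports Defs "HOL-Real_Asymp.Real_Asymp"
begin

text \<open>With \<open>p\<close> scaled by \<open>1/sqrt m\<close> the chain is \<open>u' = A u\<close> with \<open>A\<close> skew and anticommuting with the
  reflection \<open>p \<mapsto> - p\<close>. Skewness conserves the energy; both properties together give a reciprocity
  identity between two solutions, which pairs the final state of one with the final state of the other.
  Paired with solutions started from unit vectors, it shows that \<open>r\<^sub>x(s)\<close> and \<open>p\<^sub>x(s)\<close> are linear in the
  initial state with coefficients of conserved norm, so the thermal fluctuations stay \<open>1/\<beta>\<close> and
  \<open>m/\<beta>\<close> at all times, and the mean solves the chain started from the mean data. Paired with the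
  explicit normal modes, it gives the sine and cosine coefficients of the mean profile at time \<open>N t\<close>;
  these converge to the coefficients of the macroscopic solution, which satisfy a harmonic oscillator
  equation. As the sines and the cosines are dense in \<open>L\<^sup>2\<close> and the energy is bounded, the mean profile converges
  weakly. By Parseval the macroscopic energy is conserved as well, so the \<open>L\<^sup>2\<close> norms converge too:
  the convergence is strong and passes to the quadratic energy.\<close>

subsection \<open>Conservation laws of the chain\<close>

text \<open>Write \<open>J\<close> for the reflection. Skewness and \<open>J A = - A J\<close> make
  \<open>J exp(s A)\<close> symmetric, so each side of the reciprocity identity pairs the final
  state of one solution with the initial state of the other. This stands in for a matrix exponential
  and a uniqueness theorem: the solutions are given only as some family that satisfies the
  equations, and linearity in the initial state has to be extracted from that. The macroscopic pair
  is merely continuous, so neither Taylor expansion along the lattice nor multiplying the equations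
  by \<open>r\<close> and \<open>p\<close> is available. Sines and cosines are admissible test
  functions and, up to a half-site shift of the momenta, also exact normal modes of the chain; hence
  the comparison mode by mode. Only the sum of the stretch and momentum energies is conserved, so
  the two profiles must be carried together up to strong convergence. Site \<open>N\<close> has no
  stretch: its thermal energy is \<open>1/(2 \<beta>)\<close> instead of \<open>1/\<beta>\<close>, a
  defect that disappears in the average over \<open>N\<close> sites.\<close>

lemma summation_by_parts:
  fixes a b :: "nat \<Rightarrow> real"
  assumes "N \<ge> 1"
  shows "(\<Sum>x=1..N-1. a x * (b (x+1) - b x)) + (\<Sum>x=1..N. b x * (a x - a (x-1)))
           = a N * b N - a 0 * b 1"
  using assms
proof (induction N rule: nat_induct_at_least)
  case base
  then show ?case by (simp add: algebra_simps)
next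
  case (Suc n)
  then obtain k where k: "n = Suc k" by (cases n) auto
  show ?case using Suc.IH unfolding k by (simp add: algebra_simps)
qed

lemma constant_of_zero_derivative:
  fixes F :: "real \<Rightarrow> real"
  assumes "\<And>u. u \<in> {0..s} \<Longrightarrow> (F has_real_derivative 0) (at u within {0..s})" and "0 \<le> s"
  shows "F s = F 0"
  using has_field_derivative_zero_constant[of "{0..s}" F] assms by fastforce

text \<open>Only one-sided derivatives on the half-line are given; \<open>u \<mapsto> s - u\<close>
  maps \<open>{0..s}\<close> into it, so the chain rule holds up to both ends.\<close>

lemma reversed_time_derivative:
  fixes g :: "real \<Rightarrow> real"
  assumes g: "\<And>u. u \<ge> 0 \<Longrightarrow> (g has_real_derivative D u) (at u within {0..})"
    and u: "u \<in> {0..s}"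
  shows "((\<lambda>u. g (s - u)) has_real_derivative - D (s - u)) (at u within {0..s})"
proof -
  have "(\<lambda>u. s - u) ` {0..s} \<subseteq> {0..}" by auto
  with g[of "s - u"] u
  have "(g has_real_derivative D (s - u)) (at (s - u) within (\<lambda>u. s - u) ` {0..s})"
    by (auto intro: DERIV_subset)
  moreover have "((\<lambda>u. s - u) has_real_derivative - 1) (at u within {0..s})"
    by (auto intro!: derivative_eq_intros)
  ultimately have "(g \<circ> (\<lambda>u. s - u) has_real_derivative D (s - u) * - 1) (at u within {0..s})"
    by (rule DERIV_image_chain)
  then show ?thesis by (simp add: o_def)
qed

text \<open>The generator is skew for the energy form and anticommutes with \<open>p \<mapsto> - p\<close>; hence the
  form twisted by \<open>p \<mapsto> - p\<close> is constant along \<open>(u(\<tau>), u'(s - \<tau>))\<close>.\<close>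

lemma chain_reciprocity:
  assumes N: "N \<ge> 1" and m: "m \<noteq> 0" and s: "s \<ge> 0"
    and sol: "chain_solution N (\<lambda>_. m) w r p" and sol': "chain_solution N (\<lambda>_. m) w' r' p'"
  shows "(\<Sum>x=1..N-1. r s x * fst w' x) - (\<Sum>x=1..N. p s x * snd w' x) / m
       = (\<Sum>x=1..N-1. fst w x * r' s x) - (\<Sum>x=1..N. snd w x * p' s x) / m"
proof -
  \<comment> \<open>The minus sign is the reflection of the momenta. At \<open>u = s\<close> and at
    \<open>u = 0\<close> one of the two solutions is in its initial state, which gives the two sides
    of the identity.\<close>
  define F where "F u = (\<Sum>x=1..N-1. r u x * r' (s - u) x) - (\<Sum>x=1..N. p u x * p' (s - u) x) / m" for u
  have bd: "r u 0 = 0" "r u N = 0" "r' u 0 = 0" "r' u N = 0" if "u \<ge> 0" for u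
    using sol sol' that unfolding chain_solution_def by auto
  have dr: "((\<lambda>u. r u x) has_real_derivative p u (x+1) / m - p u x / m) (at u within {0..s})"
    if "u \<in> {0..s}" "x \<in> {1..N-1}" for u x
    using sol that unfolding chain_solution_def by (auto intro: DERIV_subset[of _ _ _ "{0..}"])
  have dp: "((\<lambda>u. p u x) has_real_derivative r u x - r u (x-1)) (at u within {0..s})"
    if "u \<in> {0..s}" "x \<in> {1..N}" for u x
    using sol that unfolding chain_solution_def by (auto intro: DERIV_subset[of _ _ _ "{0..}"])
  have dr': "((\<lambda>u. r' (s-u) x) has_real_derivative - (p' (s-u) (x+1) / m - p' (s-u) x / m)) (at u within {0..s})"
    if "u \<in> {0..s}" "x \<in> {1..N-1}" for u x
    by (rule reversed_time_derivative[where g="\<lambda>u. r' u x"])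
       (use sol' that in \<open>auto simp: chain_solution_def\<close>)
  have dp': "((\<lambda>u. p' (s-u) x) has_real_derivative - (r' (s-u) x - r' (s-u) (x-1))) (at u within {0..s})"
    if "u \<in> {0..s}" "x \<in> {1..N}" for u x
    by (rule reversed_time_derivative[where g="\<lambda>u. p' u x"])
       (use sol' that in \<open>auto simp: chain_solution_def\<close>)
  have "(F has_real_derivative 0) (at u within {0..s})" if u: "u \<in> {0..s}" for u
  proof -
    let ?v = "s - u"
    have "(F has_real_derivative
       (\<Sum>x=1..N-1. (p u (x+1) / m - p u x / m) * r' ?v x + - (p' ?v (x+1) / m - p' ?v x / m) * r u x)
     - (\<Sum>x=1..N. (r u x - r u (x-1)) * p' ?v x + - (r' ?v x - r' ?v (x-1)) * p u x) / m) (at u within {0..s})"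
      unfolding F_def
      by (intro DERIV_diff DERIV_sum DERIV_cdivide DERIV_mult dr dp dr' dp' u)
    moreover have "(\<Sum>x=1..N-1. (p u (x+1) / m - p u x / m) * r' ?v x + - (p' ?v (x+1) / m - p' ?v x / m) * r u x)
        = ((\<Sum>x=1..N-1. r' ?v x * (p u (x+1) - p u x)) - (\<Sum>x=1..N-1. r u x * (p' ?v (x+1) - p' ?v x))) / m"
      unfolding sum_subtractf[symmetric] sum_divide_distrib
      by (rule sum.cong) (auto simp: field_simps m)
    moreover have "(\<Sum>x=1..N. (r u x - r u (x-1)) * p' ?v x + - (r' ?v x - r' ?v (x-1)) * p u x)
        = (\<Sum>x=1..N. p' ?v x * (r u x - r u (x-1))) - (\<Sum>x=1..N. p u x * (r' ?v x - r' ?v (x-1)))"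
      unfolding sum_subtractf[symmetric] by (rule sum.cong) (auto simp: algebra_simps)
    \<comment> \<open>Here skewness enters: the stretch of either solution is summed by parts
      against the momentum of the other, and the boundary terms vanish because both stretches are
      zero at sites 0 and \<open>N\<close> at the nonnegative times \<open>u\<close> and
      \<open>s - u\<close>.\<close>
    moreover have "(\<Sum>x=1..N-1. r' ?v x * (p u (x+1) - p u x)) = - (\<Sum>x=1..N. p u x * (r' ?v x - r' ?v (x-1)))"
      using summation_by_parts[OF N, of "r' ?v" "p u"] bd[of ?v] u by auto
    moreover have "(\<Sum>x=1..N-1. r u x * (p' ?v (x+1) - p' ?v x)) = - (\<Sum>x=1..N. p' ?v x * (r u x - r u (x-1)))"
      using summation_by_parts[OF N, of "r u" "p' ?v"] bd[of u] u by auto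
    ultimately show ?thesis by (simp add: diff_divide_distrib)
  qed
  then have "F s = F 0" using s by (rule constant_of_zero_derivative)
  moreover have "F s = (\<Sum>x=1..N-1. r s x * fst w' x) - (\<Sum>x=1..N. p s x * snd w' x) / m"
    using sol' unfolding F_def chain_solution_def by simp
  moreover have "F 0 = (\<Sum>x=1..N-1. fst w x * r' s x) - (\<Sum>x=1..N. snd w x * p' s x) / m"
    using sol unfolding F_def chain_solution_def by simp
  ultimately show ?thesis by simp
qed

text \<open>Summation by parts with \<open>a = r\<close> and \<open>b = p\<close> cancels the power
  exchanged between stretches and momenta. The quantity is twice the total energy, that is, the
  squared norm in the scaled momenta.\<close>

lemma chain_energy_conservation:
  assumes N: "N \<ge> 1" and m: "m \<noteq> 0" and s: "s \<ge> 0"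
    and sol: "chain_solution N (\<lambda>_. m) w r p"
  shows "(\<Sum>x=1..N-1. (r s x)\<^sup>2) + (\<Sum>x=1..N. (p s x)\<^sup>2) / m
       = (\<Sum>x=1..N-1. (fst w x)\<^sup>2) + (\<Sum>x=1..N. (snd w x)\<^sup>2) / m"
proof -
  define F where "F u = (\<Sum>x=1..N-1. (r u x)\<^sup>2) + (\<Sum>x=1..N. (p u x)\<^sup>2) / m" for u
  have bd: "r u 0 = 0" "r u N = 0" if "u \<ge> 0" for u
    using sol that unfolding chain_solution_def by auto
  have dr: "((\<lambda>u. r u x) has_real_derivative p u (x+1) / m - p u x / m) (at u within {0..s})"
    if "u \<in> {0..s}" "x \<in> {1..N-1}" for u x
    using sol that unfolding chain_solution_def by (auto intro: DERIV_subset[of _ _ _ "{0..}"])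
  have dp: "((\<lambda>u. p u x) has_real_derivative r u x - r u (x-1)) (at u within {0..s})"
    if "u \<in> {0..s}" "x \<in> {1..N}" for u x
    using sol that unfolding chain_solution_def by (auto intro: DERIV_subset[of _ _ _ "{0..}"])
  have "(F has_real_derivative 0) (at u within {0..s})" if u: "u \<in> {0..s}" for u
  proof -
    have "(F has_real_derivative
       (\<Sum>x=1..N-1. of_nat 2 * ((p u (x+1) / m - p u x / m) * r u x ^ (2 - Suc 0)))
     + (\<Sum>x=1..N. of_nat 2 * ((r u x - r u (x-1)) * p u x ^ (2 - Suc 0))) / m) (at u within {0..s})"
      unfolding F_def
      by (intro DERIV_add DERIV_sum DERIV_cdivide DERIV_power dr dp u)
    moreover have "(\<Sum>x=1..N-1. of_nat 2 * ((p u (x+1) / m - p u x / m) * r u x ^ (2 - Suc 0)))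
        = 2 * (\<Sum>x=1..N-1. r u x * (p u (x+1) - p u x)) / m"
      unfolding sum_distrib_left sum_divide_distrib
      by (rule sum.cong) (auto simp: field_simps m)
    moreover have "(\<Sum>x=1..N. of_nat 2 * ((r u x - r u (x-1)) * p u x ^ (2 - Suc 0)))
        = 2 * (\<Sum>x=1..N. p u x * (r u x - r u (x-1)))"
      unfolding sum_distrib_left by (rule sum.cong) (auto simp: algebra_simps)
    moreover have "(\<Sum>x=1..N-1. r u x * (p u (x+1) - p u x)) = - (\<Sum>x=1..N. p u x * (r u x - r u (x-1)))"
      using summation_by_parts[OF N, of "r u" "p u"] bd[of u] u by auto
    ultimately show ?thesis by simp
  qed
  then have "F s = F 0" using s by (rule constant_of_zero_derivative)
  then show ?thesis
    using sol unfolding F_def chain_solution_def by simp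
qed

subsection \<open>Fourier series on the unit interval\<close>

lemma integral_expand_square:
  fixes h q :: "real \<Rightarrow> real"
  assumes "continuous_on {0..1} h" "continuous_on {0..1} q"
  shows "integral {0..1} (\<lambda>y. (h y - c * q y)\<^sup>2) =
    integral {0..1} (\<lambda>y. (h y)\<^sup>2) - 2 * c * integral {0..1} (\<lambda>y. h y * q y)
      + c\<^sup>2 * integral {0..1} (\<lambda>y. (q y)\<^sup>2)"
proof -
  have i: "(\<lambda>y. (h y)\<^sup>2) integrable_on {0..1}" "(\<lambda>y. h y * q y) integrable_on {0..1}" "(\<lambda>y. (q y)\<^sup>2) integrable_on {0..1}"
    using assms by (auto intro!: integrable_continuous_real continuous_intros)
  have "((\<lambda>y. (h y)\<^sup>2 - (2 * c) * (h y * q y) + c\<^sup>2 * (q y)\<^sup>2) has_integral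
    integral {0..1} (\<lambda>y. (h y)\<^sup>2) - 2 * c * integral {0..1} (\<lambda>y. h y * q y)
      + c\<^sup>2 * integral {0..1} (\<lambda>y. (q y)\<^sup>2)) {0..1}"
    by (intro has_integral_add has_integral_diff has_integral_mult_right integrable_integral i)
  then show ?thesis
    by (intro integral_unique) (simp add: power2_eq_square algebra_simps)
qed

text \<open>Adding one term at a time needs only its inner product with the error so far, which
  orthogonality reduces to its inner product with \<open>g\<close>. The coefficients are left
  arbitrary so that approximants obtained from density can be inserted.\<close>

lemma L2_error_of_partial_sum:
  fixes \<phi> :: "nat \<Rightarrow> real \<Rightarrow> real"
  assumes \<phi>: "\<And>k. continuous_on {0..1} (\<phi> k)" and g: "continuous_on {0..1} g"
    and orth: "\<And>j k. j \<noteq> k \<Longrightarrow> integral {0..1} (\<lambda>y. \<phi> j y * \<phi> k y) = 0"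
  shows "integral {0..1} (\<lambda>y. (g y - (\<Sum>k<K. c k * \<phi> k y))\<^sup>2) = integral {0..1} (\<lambda>y. (g y)\<^sup>2)
    + (\<Sum>k<K. (c k)\<^sup>2 * integral {0..1} (\<lambda>y. (\<phi> k y)\<^sup>2) - 2 * c k * integral {0..1} (\<lambda>y. g y * \<phi> k y))"
proof (induction K)
  case 0
  show ?case by simp
next
  case (Suc K)
  let ?h = "\<lambda>y. g y - (\<Sum>k<K. c k * \<phi> k y)"
  have "((\<lambda>y. g y * \<phi> K y - (\<Sum>k<K. c k * (\<phi> k y * \<phi> K y))) has_integral
     integral {0..1} (\<lambda>y. g y * \<phi> K y) - (\<Sum>k<K. c k * integral {0..1} (\<lambda>y. \<phi> k y * \<phi> K y))) {0..1}"
    by (intro has_integral_diff has_integral_sum has_integral_mult_right integrable_integral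
        integrable_continuous_real continuous_intros \<phi> g) auto
  then have cross: "integral {0..1} (\<lambda>y. ?h y * \<phi> K y) = integral {0..1} (\<lambda>y. g y * \<phi> K y)"
    by (intro integral_unique) (simp add: orth left_diff_distrib sum_distrib_right mult.assoc)
  have "integral {0..1} (\<lambda>y. (g y - (\<Sum>k<Suc K. c k * \<phi> k y))\<^sup>2) = integral {0..1} (\<lambda>y. (?h y - c K * \<phi> K y)\<^sup>2)"
    by (simp add: algebra_simps)
  also have "\<dots> = integral {0..1} (\<lambda>y. (?h y)\<^sup>2) - 2 * c K * integral {0..1} (\<lambda>y. ?h y * \<phi> K y)
      + (c K)\<^sup>2 * integral {0..1} (\<lambda>y. (\<phi> K y)\<^sup>2)"
    by (rule integral_expand_square) (intro continuous_intros \<phi> g)+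
  finally show ?case using Suc.IH by (simp add: cross)
qed

text \<open>The Fourier partial sum is the best approximant of its length, so any good approximant
  forces the Bessel sums up to the norm of \<open>g\<close>; monotonicity keeps them there.\<close>

lemma parseval_of_dense:
  fixes \<phi> :: "nat \<Rightarrow> real \<Rightarrow> real"
  assumes \<phi>: "\<And>k. continuous_on {0..1} (\<phi> k)" and g: "continuous_on {0..1} g"
    and orth: "\<And>j k. j \<noteq> k \<Longrightarrow> integral {0..1} (\<lambda>y. \<phi> j y * \<phi> k y) = 0"
    and norm: "\<And>k. integral {0..1} (\<lambda>y. (\<phi> k y)\<^sup>2) = n k" and pos: "\<And>k. n k > 0"
    and dense: "\<And>\<epsilon>. \<epsilon> > 0 \<Longrightarrow> \<exists>K c. integral {0..1} (\<lambda>y. (g y - (\<Sum>k<K. c k * \<phi> k y))\<^sup>2) < \<epsilon>"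
  shows "(\<lambda>K. \<Sum>k<K. (integral {0..1} (\<lambda>y. g y * \<phi> k y))\<^sup>2 / n k) \<longlonglongrightarrow> integral {0..1} (\<lambda>y. (g y)\<^sup>2)"
proof -
  define a where "a k = integral {0..1} (\<lambda>y. g y * \<phi> k y)" for k
  define I where "I = integral {0..1} (\<lambda>y. (g y)\<^sup>2)"
  define B where "B K = (\<Sum>k<K. (a k)\<^sup>2 / n k)" for K
  \<comment> \<open>Completing the square in each coefficient: the last sum vanishes for the Fourier
    coefficients, which gives Bessel's inequality, and is nonnegative for all others.\<close>
  have err: "integral {0..1} (\<lambda>y. (g y - (\<Sum>k<K. c k * \<phi> k y))\<^sup>2) = I - B K + (\<Sum>k<K. n k * (c k - a k / n k)\<^sup>2)" for K c
  proof -
    have sq: "(c k)\<^sup>2 * n k - 2 * c k * a k = n k * (c k - a k / n k)\<^sup>2 - (a k)\<^sup>2 / n k" for k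
      using pos[of k] by (simp add: field_simps power2_eq_square)
    have "integral {0..1} (\<lambda>y. (g y - (\<Sum>k<K. c k * \<phi> k y))\<^sup>2) = I + (\<Sum>k<K. (c k)\<^sup>2 * n k - 2 * c k * a k)"
      unfolding I_def a_def norm[symmetric] by (rule L2_error_of_partial_sum[OF \<phi> g orth])
    then show ?thesis unfolding sq sum_subtractf B_def by simp
  qed
  have upper: "B K \<le> I" for K
  proof -
    have "0 \<le> integral {0..1} (\<lambda>y. (g y - (\<Sum>k<K. a k / n k * \<phi> k y))\<^sup>2)"
      by (intro integral_nonneg integrable_continuous_real continuous_intros \<phi> g) auto
    then show ?thesis using err[of "\<lambda>k. a k / n k" K] by simp
  qed
  have mono: "B K \<le> B L" if "K \<le> L" for K L
    unfolding B_def by (rule sum_mono2) (use that pos in \<open>auto intro!: divide_nonneg_pos\<close>)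
  have "B \<longlonglongrightarrow> I"
  proof (rule LIMSEQ_I)
    fix \<epsilon> :: real assume "\<epsilon> > 0"
    from dense[OF this] obtain K c where Kc: "I - B K + (\<Sum>k<K. n k * (c k - a k / n k)\<^sup>2) < \<epsilon>"
      unfolding err by blast
    moreover have "0 \<le> (\<Sum>k<K. n k * (c k - a k / n k)\<^sup>2)"
      by (intro sum_nonneg mult_nonneg_nonneg zero_le_power2 less_imp_le[OF pos])
    ultimately have "I - B K < \<epsilon>" by linarith
    then have "norm (B L - I) < \<epsilon>" if "L \<ge> K" for L
      using upper[of L] mono[OF that] by simp
    then show "\<exists>K. \<forall>L\<ge>K. norm (B L - I) < \<epsilon>" by blast
  qed
  then show ?thesis unfolding B_def a_def I_def .
qed

section \<open>Orthogonality of the cosines and of the sines\<close>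

lemma integral_cos_pi_int:
  assumes "n \<noteq> 0"
  shows "integral {0..1} (\<lambda>y. cos (of_int n * pi * y)) = 0"
proof -
  have "((\<lambda>y. cos (of_int n * pi * y)) has_integral
      sin (of_int n * pi * 1) / (of_int n * pi) - sin (of_int n * pi * 0) / (of_int n * pi)) {0..1}"
    using assms
    by (intro fundamental_theorem_of_calculus)
       (auto intro!: derivative_eq_intros simp: has_real_derivative_iff_has_vector_derivative[symmetric])
  moreover have "sin (of_int n * pi) = 0" by (metis mult.commute sin_int_2pin sin_zero_iff_int2 )
  ultimately show ?thesis by (simp add: integral_unique)
qed

text \<open>Integer frequencies, because the product-to-sum formulas produce differences
  \<open>j - k\<close>.\<close>

lemma has_integral_cos_pi_int:
  "((\<lambda>y. cos (of_int n * pi * y)) has_integral (if n = 0 then 1 else 0)) {0..1}"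
proof -
  have "((\<lambda>y. cos (of_int n * pi * y)) has_integral integral {0..1} (\<lambda>y. cos (of_int n * pi * y))) {0..1}"
    by (intro integrable_integral integrable_continuous_real continuous_intros)
  then show ?thesis by (auto simp: integral_cos_pi_int)
qed

lemma integral_cos_cos:
  fixes j k :: nat
  shows "integral {0..1} (\<lambda>y. cos (j * pi * y) * cos (k * pi * y)) =
    (if j = k then if k = 0 then 1 else 1/2 else 0)"
proof -
  have "((\<lambda>y. (1/2) * (cos (of_int (int j - int k) * pi * y) + cos (of_int (int j + int k) * pi * y)))
     has_integral (1/2) * ((if int j - int k = 0 then 1 else 0) + (if int j + int k = 0 then 1 else 0))) {0..1}"
    by (intro has_integral_mult_right has_integral_add has_integral_cos_pi_int)
  moreover have "(\<lambda>y. (1/2) * (cos (of_int (int j - int k) * pi * y) + cos (of_int (int j + int k) * pi * y)))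
     = (\<lambda>y. cos (j * pi * y) * cos (k * pi * y))"
    by (simp add: fun_eq_iff cos_times_cos algebra_simps)
  ultimately show ?thesis by (auto dest!: integral_unique)
qed

text \<open>The index is shifted by one since the zeroth sine vanishes identically and would violate
  the positivity of norms in Parseval's identity.\<close>

lemma integral_sin_sin:
  fixes j k :: nat
  shows "integral {0..1} (\<lambda>y. sin (Suc j * pi * y) * sin (Suc k * pi * y)) = (if j = k then 1/2 else 0)"
proof -
  have "((\<lambda>y. (1/2) * (cos (of_int (int (Suc j) - int (Suc k)) * pi * y) - cos (of_int (int (Suc j) + int (Suc k)) * pi * y)))
     has_integral (1/2) * ((if int (Suc j) - int (Suc k) = 0 then 1 else 0) - (if int (Suc j) + int (Suc k) = 0 then 1 else 0))) {0..1}"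
    by (intro has_integral_mult_right has_integral_diff has_integral_cos_pi_int)
  moreover have "(\<lambda>y. (1/2) * (cos (of_int (int (Suc j) - int (Suc k)) * pi * y) - cos (of_int (int (Suc j) + int (Suc k)) * pi * y)))
     = (\<lambda>y. sin (Suc j * pi * y) * sin (Suc k * pi * y))"
    by (simp add: fun_eq_iff sin_times_sin algebra_simps)
  ultimately show ?thesis by (auto dest!: integral_unique split: if_splits)
qed

section \<open>Density of the cosines and of the sines in the L2 norm\<close>

text \<open>Building a combination one generator at a time lets closure under multiplication by
  \<open>cos (pi * y)\<close> be proved by induction, without bookkeeping of coefficients.\<close>

inductive_set lin_span :: "(nat \<Rightarrow> real \<Rightarrow> real) \<Rightarrow> (real \<Rightarrow> real) set" for \<phi> where
  zero: "(\<lambda>_. 0) \<in> lin_span \<phi>"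
| step: "q \<in> lin_span \<phi> \<Longrightarrow> (\<lambda>y. q y + c * \<phi> k y) \<in> lin_span \<phi>"

lemma lin_span_add:
  assumes "q' \<in> lin_span \<phi>" "q \<in> lin_span \<phi>"
  shows "(\<lambda>y. q y + q' y) \<in> lin_span \<phi>"
  using assms
proof (induction arbitrary: q)
  case zero
  then show ?case by simp
next
  case (step q' c k)
  show ?case using lin_span.step[OF step.IH[OF step.prems], of c k] by (simp add: add.assoc)
qed

lemma lin_span_scale:
  assumes "q \<in> lin_span \<phi>"
  shows "(\<lambda>y. a * q y) \<in> lin_span \<phi>"
  using assms
proof induction
  case zero
  then show ?case using lin_span.zero by simp
next
  case (step q c k)
  show ?case using lin_span.step[OF step.IH, of "a * c" k] by (simp add: algebra_simps)
qed

lemma lin_span_generator: "\<phi> k \<in> lin_span \<phi>"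
  using lin_span.step[OF lin_span.zero, where c=1] by simp

lemma lin_span_sum:
  "(\<And>i. i \<in> A \<Longrightarrow> q i \<in> lin_span \<phi>) \<Longrightarrow> (\<lambda>y. \<Sum>i\<in>A. q i y) \<in> lin_span \<phi>"
proof (induction A rule: infinite_finite_induct)
  case (insert x F)
  then show ?case using lin_span_add[of "\<lambda>y. \<Sum>i\<in>F. q i y" \<phi> "q x"] by simp
qed (auto intro: lin_span.zero)

lemma lin_span_coefficients:
  assumes "q \<in> lin_span \<phi>"
  shows "\<exists>K c. \<forall>y. q y = (\<Sum>k<K. c k * \<phi> k y)"
  using assms
proof induction
  case zero
  then show ?case by (intro exI[of _ 0]) simp
next
  case (step q c k)
  then obtain K d where q: "\<And>y. q y = (\<Sum>j<K. d j * \<phi> j y)" by blast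
  \<comment> \<open>Long enough to contain the old indices and \<open>k\<close>; if
    \<open>k < K\<close> already, the two coefficients at \<open>k\<close> add up.\<close>
  define L where "L = K + Suc k"
  have "q y + c * \<phi> k y = (\<Sum>j<L. ((if j < K then d j else 0) + (if j = k then c else 0)) * \<phi> j y)" for y
  proof -
    have 1: "(\<Sum>j<L. (if j = k then c else 0) * \<phi> j y) = c * \<phi> k y"
      by (simp add: if_distrib[of "\<lambda>u. u * _"] L_def cong: if_cong)
    have "(\<Sum>j<L. (if j < K then d j else 0) * \<phi> j y) = (\<Sum>j<K. d j * \<phi> j y)"
      by (rule sum.mono_neutral_cong_right) (auto simp: L_def)
    with 1 show ?thesis by (simp add: q distrib_right sum.distrib)
  qed
  then show ?case by - (rule exI, rule exI, rule allI)
qed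

text \<open>Multiplication by \<open>cos (pi * y)\<close> replaces frequency \<open>k\<close> by the
  mean of \<open>k - 1\<close> and \<open>k + 1\<close>, so it preserves the span; frequency 0,
  which has no left neighbour, simply becomes frequency 1.\<close>

lemma cos_power_in_span:
  "(\<lambda>y. cos (pi * y) ^ i) \<in> lin_span (\<lambda>k y. cos (real k * pi * y))"
proof (induction i)
  case 0
  show ?case using lin_span_generator[of "\<lambda>k y. cos (real k * pi * y)" 0] by simp
next
  case (Suc i)
  let ?\<phi> = "\<lambda>k y. cos (real k * pi * y)"
  have "(\<lambda>y. cos (pi * y) * q y) \<in> lin_span ?\<phi>" if "q \<in> lin_span ?\<phi>" for q
    using that
  proof induction
    case zero
    show ?case using lin_span.zero by simp
  next
    case (step q c k)
    have "(\<lambda>y. cos (pi * y) * ?\<phi> k y) \<in> lin_span ?\<phi>"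
    proof (cases k)
      case 0
      then show ?thesis using lin_span_generator[of ?\<phi> 1] by simp
    next
      case (Suc l)
      have "(\<lambda>y. (1/2) * (?\<phi> l y + ?\<phi> (Suc k) y)) \<in> lin_span ?\<phi>"
        using lin_span_scale[OF lin_span_add[OF lin_span_generator[of ?\<phi> "Suc k"] lin_span_generator[of ?\<phi> l]], of "1/2"] by simp
      moreover have "(\<lambda>y. (1/2) * (?\<phi> l y + ?\<phi> (Suc k) y)) = (\<lambda>y. cos (pi * y) * ?\<phi> k y)"
        by (simp add: fun_eq_iff Suc cos_times_cos algebra_simps)
      ultimately show ?thesis by simp
    qed
    from lin_span_add[OF lin_span_scale[OF this, of c] step.IH] show ?case by (simp add: algebra_simps)
  qed
  from this[OF Suc] show ?case by simp
qed

text \<open>As for the cosines, multiplication by \<open>cos (pi * y)\<close> shifts the frequency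
  by one both ways. At the lowest frequency the left neighbour is \<open>sin 0 = 0\<close>, and the
  double-angle formula leaves half of the next sine.\<close>

lemma sin_cos_power_in_span:
  "(\<lambda>y. sin (pi * y) * cos (pi * y) ^ i) \<in> lin_span (\<lambda>k y. sin (real (Suc k) * pi * y))"
proof (induction i)
  case 0
  show ?case using lin_span_generator[of "\<lambda>k y. sin (real (Suc k) * pi * y)" 0] by simp
next
  case (Suc i)
  let ?\<phi> = "\<lambda>k y. sin (real (Suc k) * pi * y)"
  have "(\<lambda>y. cos (pi * y) * q y) \<in> lin_span ?\<phi>" if "q \<in> lin_span ?\<phi>" for q
    using that
  proof induction
    case zero
    show ?case using lin_span.zero by simp
  next
    case (step q c k)
    have "(\<lambda>y. cos (pi * y) * ?\<phi> k y) \<in> lin_span ?\<phi>"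
    proof (cases k)
      case 0
      have "(\<lambda>y. (1/2) * ?\<phi> 1 y) \<in> lin_span ?\<phi>"
        by (intro lin_span_scale lin_span_generator)
      moreover have "(\<lambda>y. (1/2) * ?\<phi> 1 y) = (\<lambda>y. cos (pi * y) * ?\<phi> k y)"
        by (simp add: fun_eq_iff 0 mult.assoc sin_double)
      ultimately show ?thesis by simp
    next
      case (Suc l)
      have "(\<lambda>y. (1/2) * (?\<phi> l y + ?\<phi> (Suc k) y)) \<in> lin_span ?\<phi>"
        using lin_span_scale[OF lin_span_add[OF lin_span_generator[of ?\<phi> "Suc k"] lin_span_generator[of ?\<phi> l]], of "1/2"] by simp
      moreover have "(\<lambda>y. (1/2) * (?\<phi> l y + ?\<phi> (Suc k) y)) = (\<lambda>y. cos (pi * y) * ?\<phi> k y)"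
        unfolding mult.commute[of "cos _"] sin_times_cos by (simp add: fun_eq_iff Suc algebra_simps)
      ultimately show ?thesis by simp
    qed
    from lin_span_add[OF lin_span_scale[OF this, of c] step.IH] show ?case by (simp add: algebra_simps)
  qed
  from this[OF Suc] show ?case by (simp add: mult.left_commute)
qed

text \<open>The substitution \<open>z = cos (pi * y)\<close> is a homeomorphism of
  \<open>{0..1}\<close> onto \<open>{-1..1}\<close>, so this is Weierstrass approximation in the
  variable \<open>z\<close>.\<close>

lemma cosine_polynomial_approximation:
  fixes g :: "real \<Rightarrow> real"
  assumes g: "continuous_on {0..1} g" and "\<epsilon> > 0"
  obtains a n where "\<And>y. y \<in> {0..1} \<Longrightarrow> \<bar>g y - (\<Sum>i\<le>n. a i * cos (pi * y) ^ i)\<bar> < \<epsilon>"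
proof -
  have "continuous_on {-1..1} (\<lambda>z. g (arccos z / pi))"
    by (rule continuous_on_compose2[OF g])
       (auto intro!: continuous_intros simp: arccos_lbound arccos_ubound divide_le_eq)
  then obtain q where q: "real_polynomial_function q" "\<And>z. z \<in> {-1..1} \<Longrightarrow> \<bar>g (arccos z / pi) - q z\<bar> < \<epsilon>"
    using Stone_Weierstrass_real_polynomial_function[of "{-1..1::real}"] \<open>\<epsilon> > 0\<close>
    by (metis compact_Icc)
  from q(1) obtain a n where an: "q = (\<lambda>x. \<Sum>i\<le>n. a i * x ^ i)"
    unfolding real_polynomial_function_iff_sum by blast
  have "\<bar>g y - (\<Sum>i\<le>n. a i * cos (pi * y) ^ i)\<bar> < \<epsilon>" if "y \<in> {0..1}" for y
    using q(2)[of "cos (pi * y)"] that by (simp add: an arccos_cos mult_left_le)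
  then show thesis by (rule that)
qed

lemma integral_square_less:
  fixes h :: "real \<Rightarrow> real"
  assumes "continuous_on {0..1} h" "\<And>y. y \<in> {0..1} \<Longrightarrow> \<bar>h y\<bar> \<le> \<delta>" "\<delta>\<^sup>2 < \<epsilon>"
  shows "integral {0..1} (\<lambda>y. (h y)\<^sup>2) < \<epsilon>"
proof -
  have "integral {0..1} (\<lambda>y. (h y)\<^sup>2) \<le> integral {0..1} (\<lambda>y::real. \<delta>\<^sup>2)"
    using assms(2) by (intro integral_le integrable_continuous_real continuous_intros assms(1)) (auto intro: order_trans[OF _ abs_ge_self] simp: abs_le_square_iff[symmetric])
  then show ?thesis using assms(3) by simp
qed

lemma cosines_dense:
  assumes g: "continuous_on {0..1} g" and "\<epsilon> > 0"
  shows "\<exists>K c. integral {0..1} (\<lambda>y. (g y - (\<Sum>k<K. c k * cos (real k * pi * y)))\<^sup>2) < \<epsilon>"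
proof -
  define \<delta> where "\<delta> = sqrt \<epsilon> / 2"
  have \<delta>: "\<delta> > 0" "\<delta>\<^sup>2 < \<epsilon>" using \<open>\<epsilon> > 0\<close> by (auto simp: \<delta>_def power_divide)
  obtain a n where an: "\<And>y. y \<in> {0..1} \<Longrightarrow> \<bar>g y - (\<Sum>i\<le>n. a i * cos (pi * y) ^ i)\<bar> < \<delta>"
    using cosine_polynomial_approximation[OF g \<delta>(1)] by metis
  have "(\<lambda>y. \<Sum>i\<le>n. a i * cos (pi * y) ^ i) \<in> lin_span (\<lambda>k y. cos (real k * pi * y))"
    by (intro lin_span_sum lin_span_scale cos_power_in_span)
  from lin_span_coefficients[OF this] obtain K c
    where c: "\<And>y. (\<Sum>i\<le>n. a i * cos (pi * y) ^ i) = (\<Sum>k<K. c k * cos (real k * pi * y))" by blast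
  have "integral {0..1} (\<lambda>y. (g y - (\<Sum>k<K. c k * cos (real k * pi * y)))\<^sup>2) < \<epsilon>"
    using an by (intro integral_square_less[OF _ _ \<delta>(2)] continuous_intros g) (auto simp: c intro: less_imp_le)
  then show ?thesis by blast
qed

text \<open>Sines vanish at the endpoints, so \<open>g\<close> is first replaced by \<open>g n sin / (1 + n sin)\<close>, which is
  \<open>L\<^sup>2\<close>-close to \<open>g\<close> and is \<open>sin\<close> times a continuous function.\<close>

lemma sines_dense:
  assumes g: "continuous_on {0..1} g" and "\<epsilon> > 0"
  shows "\<exists>K c. integral {0..1} (\<lambda>y. (g y - (\<Sum>k<K. c k * sin (real (Suc k) * pi * y)))\<^sup>2) < \<epsilon>"
proof -
  have sin0: "0 \<le> sin (pi * y)" if "y \<in> {0..1}" for y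
    using that by (intro sin_ge_zero) (auto simp: mult_left_le)
  have pos: "0 < 1 + real n * sin (pi * y)" if "y \<in> {0..1}" for n y
    using mult_nonneg_nonneg[OF _ sin0[OF that], of "real n"] by linarith
  have ne: "1 + real n * sin (pi * y) \<noteq> 0" if "y \<in> {0..1}" for n y
    using pos[OF that, of n] by linarith
  have cont: "continuous_on {0..1} (\<lambda>y. g y / (1 + real n * sin (pi * y)))" for n
    by (intro continuous_intros g) (auto simp: ne)
  \<comment> \<open>The quotient is exactly the error of the replacement by
    \<open>g n sin / (1 + n sin)\<close>. It tends to 0 wherever the sine is positive and stays
    equal to \<open>g\<close> at the two endpoints, which form a null set; \<open>g\<close> squared
    dominates.\<close>
  have "(\<lambda>n. integral {0..1} (\<lambda>y. (g y / (1 + real n * sin (pi * y)))\<^sup>2)) \<longlonglongrightarrow>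
      integral {0..1} (\<lambda>y. if y = 0 \<or> y = 1 then (g y)\<^sup>2 else 0)"
  proof (rule dominated_convergence(2)[where h="\<lambda>y. (g y)\<^sup>2"])
    show "(\<lambda>y. (g y / (1 + real n * sin (pi * y)))\<^sup>2) integrable_on {0..1}" for n
      by (intro integrable_continuous_real continuous_intros cont)
    show "(\<lambda>y. (g y)\<^sup>2) integrable_on {0..1}"
      by (intro integrable_continuous_real continuous_intros g)
    show "norm ((g y / (1 + real n * sin (pi * y)))\<^sup>2) \<le> (g y)\<^sup>2" if "y \<in> {0..1}" for n y
    proof -
      have "1 \<le> 1 + real n * sin (pi * y)" using sin0[OF that] by simp
      then have "1 \<le> (1 + real n * sin (pi * y))\<^sup>2" by (rule one_le_power)
      then have "(g y)\<^sup>2 / (1 + real n * sin (pi * y))\<^sup>2 \<le> (g y)\<^sup>2 / 1"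
        by (intro divide_left_mono) auto
      then show ?thesis by (simp add: power_divide)
    qed
    show "(\<lambda>n. (g y / (1 + real n * sin (pi * y)))\<^sup>2) \<longlonglongrightarrow> (if y = 0 \<or> y = 1 then (g y)\<^sup>2 else 0)"
      if "y \<in> {0..1}" for y
    proof (cases "y = 0 \<or> y = 1")
      case True
      then show ?thesis by auto
    next
      case False
      with that have s: "sin (pi * y) > 0" by (intro sin_gt_zero) auto
      have "(\<lambda>n. g y / (1 + real n * sin (pi * y))) \<longlonglongrightarrow> 0"
        by (intro real_tendsto_divide_at_top[OF tendsto_const] filterlim_tendsto_add_at_top[OF tendsto_const]
            filterlim_at_top_mult_tendsto_pos[OF tendsto_const s] filterlim_real_sequentially)
      from tendsto_power[OF this, of 2] False show ?thesis by simp
    qed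
  qed
  moreover have "integral {0..1} (\<lambda>y. if y = 0 \<or> y = 1 then (g y)\<^sup>2 else 0) = 0"
    by (rule integral_unique, rule has_integral_spike_finite[of "{0,1}" _ _ "\<lambda>_. 0"]) auto
  ultimately have "(\<lambda>n. integral {0..1} (\<lambda>y. (g y / (1 + real n * sin (pi * y)))\<^sup>2)) \<longlonglongrightarrow> 0" by simp
  then have "eventually (\<lambda>n. integral {0..1} (\<lambda>y. (g y / (1 + real n * sin (pi * y)))\<^sup>2) < \<epsilon> / 4) sequentially"
    using \<open>\<epsilon> > 0\<close> by (intro order_tendstoD(2)) auto
  then obtain l where l: "integral {0..1} (\<lambda>y. (g y / (1 + real l * sin (pi * y)))\<^sup>2) < \<epsilon> / 4"
    by (auto simp: eventually_sequentially)
  \<comment> \<open>The cofactor of the sine in the replacement: approximating \<open>h\<close> by a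
    polynomial \<open>Q\<close> in the cosine puts \<open>sin * Q\<close> into the span of the
    sines.\<close>
  define h where "h y = g y * real l / (1 + real l * sin (pi * y))" for y
  have h: "continuous_on {0..1} h"
    unfolding h_def by (intro continuous_intros g) (auto simp: ne)
  \<comment> \<open>Error budget: by \<open>(A + B)^2 \<le> 2 A^2 + 2 B^2\<close> each of the two
    errors may contribute a squared integral below \<open>\<epsilon> / 4\<close>; here the square is
    \<open>\<epsilon> / 16\<close>.\<close>
  define \<delta> where "\<delta> = sqrt (\<epsilon> / 16)"
  have \<delta>: "\<delta> > 0" "\<delta>\<^sup>2 < \<epsilon> / 4" using \<open>\<epsilon> > 0\<close> by (auto simp: \<delta>_def)
  obtain a n where an: "\<And>y. y \<in> {0..1} \<Longrightarrow> \<bar>h y - (\<Sum>i\<le>n. a i * cos (pi * y) ^ i)\<bar> < \<delta>"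
    using cosine_polynomial_approximation[OF h \<delta>(1)] by metis
  define Q where "Q y = (\<Sum>i\<le>n. a i * cos (pi * y) ^ i)" for y
  have "(\<lambda>y. \<Sum>i\<le>n. a i * (sin (pi * y) * cos (pi * y) ^ i)) \<in> lin_span (\<lambda>k y. sin (real (Suc k) * pi * y))"
    by (intro lin_span_sum lin_span_scale sin_cos_power_in_span)
  from lin_span_coefficients[OF this] obtain K c
    where c: "\<And>y. sin (pi * y) * Q y = (\<Sum>k<K. c k * sin (real (Suc k) * pi * y))"
    by (auto simp: Q_def sum_distrib_left mult.left_commute)
  have contQ: "continuous_on {0..1} Q" unfolding Q_def by (intro continuous_intros)
  let ?u = "\<lambda>y. g y / (1 + real l * sin (pi * y))" and ?v = "\<lambda>y. sin (pi * y) * (h y - Q y)"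
  have int: "(\<lambda>y. (?u y)\<^sup>2) integrable_on {0..1}" "(\<lambda>y. (?v y)\<^sup>2) integrable_on {0..1}"
    by (intro integrable_continuous_real continuous_intros cont h contQ)+
  have "integral {0..1} (\<lambda>y. (g y - sin (pi * y) * Q y)\<^sup>2)
      \<le> integral {0..1} (\<lambda>y. 2 * (?u y)\<^sup>2 + 2 * (?v y)\<^sup>2)"
  proof (rule integral_le)
    fix y :: real assume y: "y \<in> {0..1}"
    have "?u y + sin (pi * y) * h y = g y"
    proof -
      define d where "d = 1 + real l * sin (pi * y)"
      have "d \<noteq> 0" using ne[OF y] by (simp add: d_def)
      moreover have "g y + sin (pi * y) * (g y * real l) = g y * d" by (simp add: d_def algebra_simps)
      ultimately show ?thesis unfolding h_def d_def[symmetric] by (simp add: field_simps)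
    qed
    then have "g y - sin (pi * y) * Q y = ?u y + ?v y" by (simp add: algebra_simps)
    moreover have "(A + B)\<^sup>2 \<le> 2 * A\<^sup>2 + 2 * B\<^sup>2" for A B :: real
      using zero_le_power2[of "A - B"] by (simp add: power2_eq_square algebra_simps)
    ultimately show "(g y - sin (pi * y) * Q y)\<^sup>2 \<le> 2 * (?u y)\<^sup>2 + 2 * (?v y)\<^sup>2" by metis
  qed (intro integrable_continuous_real continuous_intros cont h contQ g)+
  also have "\<dots> = 2 * integral {0..1} (\<lambda>y. (?u y)\<^sup>2) + 2 * integral {0..1} (\<lambda>y. (?v y)\<^sup>2)"
    by (rule integral_unique, intro has_integral_add has_integral_mult_right integrable_integral int)
  also have "integral {0..1} (\<lambda>y. (?v y)\<^sup>2) < \<epsilon> / 4"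
  proof (rule integral_square_less[OF _ _ \<delta>(2)])
    fix y :: real assume y: "y \<in> {0..1}"
    have "\<bar>sin (pi * y)\<bar> * \<bar>h y - Q y\<bar> \<le> 1 * \<delta>"
      using an[OF y] unfolding Q_def[symmetric] by (intro mult_mono) auto
    then show "\<bar>sin (pi * y) * (h y - Q y)\<bar> \<le> \<delta>" by (simp add: abs_mult)
  qed (intro continuous_intros h contQ)
  finally have "integral {0..1} (\<lambda>y. (g y - sin (pi * y) * Q y)\<^sup>2) < \<epsilon>" using l by simp
  then show ?thesis unfolding c by blast
qed

lemma parseval_cosine:
  assumes "continuous_on {0..1} g"
  shows "(\<lambda>K. \<Sum>k<K. (integral {0..1} (\<lambda>y. g y * cos (real k * pi * y)))\<^sup>2 / (if k = 0 then 1 else 1/2))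
    \<longlonglongrightarrow> integral {0..1} (\<lambda>y. (g y)\<^sup>2)"
  by (rule parseval_of_dense[OF _ assms])
     (auto intro!: continuous_intros simp: integral_cos_cos power2_eq_square
       cosines_dense[OF assms, unfolded power2_eq_square])

lemma parseval_sine:
  assumes "continuous_on {0..1} g"
  shows "(\<lambda>K. \<Sum>k<K. (integral {0..1} (\<lambda>y. g y * sin (real (Suc k) * pi * y)))\<^sup>2 / (1/2))
    \<longlonglongrightarrow> integral {0..1} (\<lambda>y. (g y)\<^sup>2)"
  by (rule parseval_of_dense[OF _ assms])
     (auto intro!: continuous_intros simp: integral_sin_sin[unfolded of_nat_Suc] power2_eq_square
       sines_dense[OF assms, unfolded power2_eq_square of_nat_Suc])

subsection \<open>The macroscopic equations\<close>

text \<open>A derivative multiplies by \<open>a\<close> and advances the phase by a quarter turn, so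
  one closed formula gives all derivatives, and sine and cosine are two choices of
  \<open>b\<close>.\<close>

lemma smooth_unit_phase:
  "smooth_unit (\<lambda>y. sin (a * y + b))"
  unfolding smooth_unit_def Ck_unit_def
proof (intro allI exI[of _ "\<lambda>j y. a ^ j * sin (a * y + b + real j * (pi / 2))"] conjI ballI impI)
  fix j :: nat and y :: real
  have "cos (a * y + b + real j * (pi / 2)) = sin (a * y + b + real (Suc j) * (pi / 2))"
  proof -
    have "a * y + b + real (Suc j) * (pi / 2) = (a * y + b + real j * (pi / 2)) + pi / 2"
      by (simp add: algebra_simps)
    then show ?thesis by (simp only: sin_add cos_pi_half sin_pi_half)
  qed
  then show "((\<lambda>y. a ^ j * sin (a * y + b + real j * (pi / 2))) has_real_derivative
      a ^ Suc j * sin (a * y + b + real (Suc j) * (pi / 2))) (at y within {0..1})"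
    by (auto intro!: derivative_eq_intros)
qed (auto intro!: continuous_intros)

lemma smooth_unit_sin: "smooth_unit (\<lambda>y. sin (a * y))"
  using smooth_unit_phase[of a 0] by simp

lemma smooth_unit_cos: "smooth_unit (\<lambda>y. cos (a * y))"
  using smooth_unit_phase[of a "pi/2"] by (simp add: sin_add)

text \<open>The difference from the explicit rotation solves the homogeneous system, whose conserved
  form is \<open>c^2 u^2 + v^2\<close>; it starts at 0 and hence stays there. The equations are in
  integral form because that is what the weak formulation supplies.\<close>

lemma harmonic_oscillator_solution:
  fixes u v :: "real \<Rightarrow> real"
  assumes c: "c > 0" and t: "t \<in> {0..T}"
    and contu: "continuous_on {0..T} u" and contv: "continuous_on {0..T} v"
    and u: "\<And>t. t \<in> {0..T} \<Longrightarrow> u t = u0 - b / c\<^sup>2 * integral {0..t} v"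
    and v: "\<And>t. t \<in> {0..T} \<Longrightarrow> v t = v0 + b * integral {0..t} u"
  shows "u t = cos (b / c * t) * u0 - sin (b / c * t) * v0 / c"
    and "v t = cos (b / c * t) * v0 + c * sin (b / c * t) * u0"
proof -
  define U where "U t = cos (b / c * t) * u0 - sin (b / c * t) * v0 / c" for t
  define V where "V t = cos (b / c * t) * v0 + c * sin (b / c * t) * u0" for t
  define F where "F t = c\<^sup>2 * (u t - U t)\<^sup>2 + (v t - V t)\<^sup>2" for t
  have dU: "(U has_real_derivative - b / c\<^sup>2 * V s) (at s within {0..T})" for s
    unfolding U_def V_def using c
    by (auto intro!: derivative_eq_intros simp: field_simps power2_eq_square)
  have dV: "(V has_real_derivative b * U s) (at s within {0..T})" for s
    unfolding U_def V_def using c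
    by (auto intro!: derivative_eq_intros simp: field_simps power2_eq_square)
  have du: "(u has_real_derivative - b / c\<^sup>2 * v s) (at s within {0..T})" if "s \<in> {0..T}" for s
  proof (unfold has_field_derivative_def, rule has_derivative_transform[OF that u], assumption, fold has_field_derivative_def)
    show "((\<lambda>t. u0 - b / c\<^sup>2 * integral {0..t} v) has_real_derivative - b / c\<^sup>2 * v s) (at s within {0..T})"
      using DERIV_diff[OF DERIV_const[where k=u0]
        DERIV_cmult[OF integral_has_real_derivative[OF contv that], where c="b / c\<^sup>2"]] by simp
  qed
  have dv: "(v has_real_derivative b * u s) (at s within {0..T})" if "s \<in> {0..T}" for s
  proof (unfold has_field_derivative_def, rule has_derivative_transform[OF that v], assumption, fold has_field_derivative_def)
    show "((\<lambda>t. v0 + b * integral {0..t} u) has_real_derivative b * u s) (at s within {0..T})"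
      using DERIV_add[OF DERIV_const[where k=v0]
        DERIV_cmult[OF integral_has_real_derivative[OF contu that], where c=b]] by simp
  qed
  have "(F has_real_derivative 0) (at s within {0..t})" if s: "s \<in> {0..t}" for s
  proof -
    have sT: "s \<in> {0..T}" using s t by auto
    have "(F has_real_derivative
        c\<^sup>2 * (of_nat 2 * ((- b / c\<^sup>2 * v s - - b / c\<^sup>2 * V s) * (u s - U s) ^ (2 - Suc 0)))
        + of_nat 2 * ((b * u s - b * U s) * (v s - V s) ^ (2 - Suc 0))) (at s within {0..T})"
      unfolding F_def by (intro DERIV_add DERIV_cmult DERIV_power DERIV_diff du dv dU dV sT)
    moreover have "c\<^sup>2 * (of_nat 2 * ((- b / c\<^sup>2 * v s - - b / c\<^sup>2 * V s) * (u s - U s) ^ (2 - Suc 0)))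
        + of_nat 2 * ((b * u s - b * U s) * (v s - V s) ^ (2 - Suc 0)) = 0"
      using c by (simp add: field_simps)
    ultimately have "(F has_real_derivative 0) (at s within {0..T})" by simp
    then show ?thesis using t by (auto intro: DERIV_subset)
  qed
  then have "F t = F 0" using t by (intro constant_of_zero_derivative) auto
  also have "F 0 = 0" using u[of 0] v[of 0] t by (simp add: F_def U_def V_def)
  finally have "c\<^sup>2 * (u t - U t)\<^sup>2 = 0 \<and> (v t - V t)\<^sup>2 = 0"
    unfolding F_def by (subst (asm) add_nonneg_eq_0_iff) auto
  then have "u t = U t" "v t = V t" using c by auto
  then show "u t = cos (b / c * t) * u0 - sin (b / c * t) * v0 / c"
    and "v t = cos (b / c * t) * v0 + c * sin (b / c * t) * u0"
    by (auto simp: U_def V_def)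
qed

text \<open>Continuity in time of the coefficients is what allows their integral equations to be
  differentiated. Space and time are swapped in the proof because the parameter theorem integrates
  over the second component.\<close>

lemma continuous_on_mode:
  fixes q :: "real \<Rightarrow> real \<Rightarrow> real"
  assumes q: "continuous_on ({0..1} \<times> {0..T}) (\<lambda>(y, t). q y t)" and h: "continuous_on {0..1} h"
  shows "continuous_on {0..T} (\<lambda>t. integral {0..1} (\<lambda>y. q y t * h y))"
proof -
  have "continuous_on ({0..T} \<times> {0..1}) (\<lambda>z. q (snd z) (fst z))"
  proof -
    have "continuous_on ({0..T} \<times> {0..1}) (\<lambda>z. (\<lambda>(y, t). q y t) (snd z, fst z))"
      by (rule continuous_on_compose2[OF q]) (auto intro!: continuous_intros)
    then show ?thesis by simp
  qed
  moreover have "continuous_on ({0..T} \<times> {0..1}) (\<lambda>z. h (snd z))"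
    by (rule continuous_on_compose2[OF h]) (auto intro!: continuous_intros)
  ultimately have "continuous_on ({0..T} \<times> cbox 0 1) (\<lambda>(t, y). q y t * h y)"
    by (auto simp: split_beta intro: continuous_intros)
  from integral_continuous_on_param[OF this] show ?thesis by simp
qed

lemma continuous_on_time_slice:
  fixes q :: "real \<Rightarrow> real \<Rightarrow> real"
  assumes q: "continuous_on ({0..1} \<times> {0..T}) (\<lambda>(y, t). q y t)" and "t \<in> {0..T}"
  shows "continuous_on {0..1} (\<lambda>y. q y t)"
proof -
  have "continuous_on {0..1} (\<lambda>y. (\<lambda>(y, t). q y t) (y, t))"
    by (rule continuous_on_compose2[OF q]) (use assms(2) in \<open>auto intro!: continuous_intros\<close>)
  then show ?thesis by simp
qed

lemma macro_solution_weak_r: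
  assumes "macro_solution m \<beta> T rini pini r p e" "smooth_unit f" "f 0 = 0" "f 1 = 0"
    and "\<And>y. y \<in> {0..1} \<Longrightarrow> (f has_real_derivative f' y) (at y within {0..1})" "t \<in> {0..T}"
  shows "integral {0..1} (\<lambda>y. r y t * f y) = integral {0..1} (\<lambda>y. rini y * f y)
           - 1 / m * integral {0..t} (\<lambda>s. integral {0..1} (\<lambda>y. p y s * f' y))"
  by (rule assms(1)[unfolded macro_solution_def, THEN conjunct2, THEN conjunct2, THEN conjunct1,
      rule_format, OF assms(2-6)])

lemma macro_solution_weak_p:
  assumes "macro_solution m \<beta> T rini pini r p e" "smooth_unit g"
    and "\<And>y. y \<in> {0..1} \<Longrightarrow> (g has_real_derivative g' y) (at y within {0..1})" "t \<in> {0..T}"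
  shows "integral {0..1} (\<lambda>y. p y t * g y) = integral {0..1} (\<lambda>y. pini y * g y)
           - integral {0..t} (\<lambda>s. integral {0..1} (\<lambda>y. r y s * g' y))"
  by (rule assms(1)[unfolded macro_solution_def, THEN conjunct2, THEN conjunct2, THEN conjunct2, THEN conjunct1,
      rule_format, OF assms(2-4)])

text \<open>The sine vanishes at both ends, so it is admissible in the equation for
  \<open>r\<close>; its derivative is a cosine, admissible in the equation for \<open>p\<close>,
  whose derivative is a sine again. The two coefficients thus close up into an oscillator with
  \<open>b = k pi\<close> and \<open>c = sqrt m\<close>.\<close>

lemma macro_solution_modes:
  fixes k :: nat
  assumes sol: "macro_solution m \<beta> T rini pini r p e" and m: "m > 0" and t: "t \<in> {0..T}"
  shows "integral {0..1} (\<lambda>y. r y t * sin (real k * pi * y)) =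
      cos (real k * pi / sqrt m * t) * integral {0..1} (\<lambda>y. rini y * sin (real k * pi * y))
      - sin (real k * pi / sqrt m * t) * integral {0..1} (\<lambda>y. pini y * cos (real k * pi * y)) / sqrt m" (is ?r)
    and "integral {0..1} (\<lambda>y. p y t * cos (real k * pi * y)) =
      cos (real k * pi / sqrt m * t) * integral {0..1} (\<lambda>y. pini y * cos (real k * pi * y))
      + sqrt m * sin (real k * pi / sqrt m * t) * integral {0..1} (\<lambda>y. rini y * sin (real k * pi * y))" (is ?p)
proof -
  let ?b = "real k * pi"
  define u where "u t = integral {0..1} (\<lambda>y. r y t * sin (?b * y))" for t
  define v where "v t = integral {0..1} (\<lambda>y. p y t * cos (?b * y))" for t
  have contu: "continuous_on {0..T} u" and contv: "continuous_on {0..T} v"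
    unfolding u_def v_def using sol unfolding macro_solution_def
    by (auto intro!: continuous_on_mode continuous_intros)
  have u: "u t = integral {0..1} (\<lambda>y. rini y * sin (?b * y)) - ?b / (sqrt m)\<^sup>2 * integral {0..t} v"
    if "t \<in> {0..T}" for t
  proof -
    have "u t = integral {0..1} (\<lambda>y. rini y * sin (?b * y))
         - 1 / m * integral {0..t} (\<lambda>s. integral {0..1} (\<lambda>y. p y s * (?b * cos (?b * y))))"
      unfolding u_def
      by (rule macro_solution_weak_r[OF sol smooth_unit_sin _ _ _ that]) (auto intro!: derivative_eq_intros)
    also have "(\<lambda>s. integral {0..1} (\<lambda>y. p y s * (?b * cos (?b * y)))) = (\<lambda>s. ?b * v s)"
      unfolding v_def integral_mult_right[symmetric] by (simp only: mult.left_commute)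
    finally show ?thesis using m by simp
  qed
  have v: "v t = integral {0..1} (\<lambda>y. pini y * cos (?b * y)) + ?b * integral {0..t} u"
    if "t \<in> {0..T}" for t
  proof -
    have "v t = integral {0..1} (\<lambda>y. pini y * cos (?b * y))
         - integral {0..t} (\<lambda>s. integral {0..1} (\<lambda>y. r y s * (- ?b * sin (?b * y))))"
      unfolding v_def
      by (rule macro_solution_weak_p[OF sol smooth_unit_cos _ that]) (auto intro!: derivative_eq_intros)
    also have "(\<lambda>s. integral {0..1} (\<lambda>y. r y s * (- ?b * sin (?b * y)))) = (\<lambda>s. - ?b * u s)"
      unfolding u_def integral_mult_right[symmetric] by (simp only: mult.left_commute)
    also have "integral {0..t} (\<lambda>s. - ?b * u s) = - ?b * integral {0..t} u"
      by (rule integral_mult_right)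
    finally show ?thesis by simp
  qed
  have "sqrt m > 0" using m by simp
  note sol' = harmonic_oscillator_solution[where c="sqrt m" and b="?b", OF this t contu contv u v]
  show ?r using sol'(1) unfolding u_def by simp
  show ?p using sol'(2) unfolding v_def by simp
qed

text \<open>For merely continuous \<open>r\<close> and \<open>p\<close> the energy cannot be
  differentiated directly. Parseval writes it as a sum over modes, and each pair of a sine and a
  cosine coefficient only rotates.\<close>

lemma macro_energy_conservation:
  assumes sol: "macro_solution m \<beta> T rini pini r p e" and m: "m > 0" and t: "t \<in> {0..T}"
    and rini: "continuous_on {0..1} rini" and pini: "continuous_on {0..1} pini"
  shows "integral {0..1} (\<lambda>y. (r y t)\<^sup>2) + integral {0..1} (\<lambda>y. (p y t)\<^sup>2) / m
       = integral {0..1} (\<lambda>y. (rini y)\<^sup>2) + integral {0..1} (\<lambda>y. (pini y)\<^sup>2) / m"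
proof -
  have r: "continuous_on {0..1} (\<lambda>y. r y t)" and p: "continuous_on {0..1} (\<lambda>y. p y t)"
    using sol t unfolding macro_solution_def by (auto intro: continuous_on_time_slice)
  define a where "a g k = integral {0..1} (\<lambda>y. g y * sin (real k * pi * y))" for g :: "real \<Rightarrow> real" and k
  define b where "b g k = integral {0..1} (\<lambda>y. g y * cos (real k * pi * y))" for g :: "real \<Rightarrow> real" and k
  \<comment> \<open>The cosine sum has one term more, the constant mode; then sine and cosine of the
    same frequency \<open>Suc k\<close> are present together, and the partial sums themselves, not
    just their limits, are conserved.\<close>
  define S where "S u v K = (\<Sum>k<K. (a u (Suc k))\<^sup>2 / (1/2)) + (\<Sum>k<Suc K. (b v k)\<^sup>2 / (if k = 0 then 1 else 1/2)) / m" for u v K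
  have lim: "S u v \<longlonglongrightarrow> integral {0..1} (\<lambda>y. (u y)\<^sup>2) + integral {0..1} (\<lambda>y. (v y)\<^sup>2) / m"
    if "continuous_on {0..1} u" "continuous_on {0..1} v" for u v
    unfolding S_def a_def b_def
    by (intro tendsto_add tendsto_divide tendsto_const parseval_sine that LIMSEQ_Suc[OF parseval_cosine]) (use m in auto)
  have S: "S u v K = (b v 0)\<^sup>2 / m + 2 * (\<Sum>k<K. (a u (Suc k))\<^sup>2 + (b v (Suc k))\<^sup>2 / m)" for u v K
    unfolding S_def by (subst sum.lessThan_Suc_shift) (simp add: sum.distrib sum_distrib_left sum_divide_distrib add_divide_distrib field_simps)
  have mode: "(a (\<lambda>y. r y t) k)\<^sup>2 + (b (\<lambda>y. p y t) k)\<^sup>2 / m = (a rini k)\<^sup>2 + (b pini k)\<^sup>2 / m" for k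
  proof -
    define C where "C = cos (real k * pi / sqrt m * t)"
    define D where "D = sin (real k * pi / sqrt m * t)"
    have CD: "D\<^sup>2 = 1 - C\<^sup>2" unfolding C_def D_def by (rule sin_squared_eq)
    have "sqrt m > 0" using m by simp
    moreover have "m = (sqrt m)\<^sup>2" using m by simp
    ultimately have id: "(C * A - D * B / sqrt m)\<^sup>2 + (C * B + sqrt m * D * A)\<^sup>2 / m = (C\<^sup>2 + D\<^sup>2) * (A\<^sup>2 + B\<^sup>2 / m)" for A B
      by (simp add: power2_eq_square field_simps)
    show ?thesis
      unfolding a_def b_def macro_solution_modes[OF sol m t]
      unfolding a_def[symmetric] b_def[symmetric] C_def[symmetric] D_def[symmetric] id CD by simp
  qed
  have mode0: "(b (\<lambda>y. p y t) 0)\<^sup>2 = (b pini 0)\<^sup>2"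
    using macro_solution_modes(2)[OF sol m t, of 0] by (simp add: b_def)
  have "S (\<lambda>y. r y t) (\<lambda>y. p y t) = S rini pini"
    by (rule ext) (simp add: S mode mode0)
  with lim[OF r p] lim[OF rini pini] show ?thesis
    using LIMSEQ_unique by metis
qed

subsection \<open>Gaussian moments\<close>

lemma phase_integral_prod:
  fixes F G :: "nat \<Rightarrow> real \<Rightarrow> real"
  assumes F: "\<And>i. i \<in> {1..N-1} \<Longrightarrow> integrable lborel (F i)"
    and G: "\<And>j. j \<in> {1..N} \<Longrightarrow> integrable lborel (G j)"
  shows "has_bochner_integral (phase_lborel N)
      (\<lambda>w. (\<Prod>i=1..N-1. F i (fst w i)) * (\<Prod>j=1..N. G j (snd w j)))
      ((\<Prod>i=1..N-1. integral\<^sup>L lborel (F i)) * (\<Prod>j=1..N. integral\<^sup>L lborel (G j)))"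
proof -
  interpret L: product_sigma_finite "\<lambda>_::nat. lborel :: real measure" ..
  let ?A = "PiM {1..N-1} (\<lambda>_. lborel :: real measure)" and ?B = "PiM {1..N} (\<lambda>_. lborel :: real measure)"
  interpret A: sigma_finite_measure ?A by (rule L.sigma_finite) simp
  interpret B: sigma_finite_measure ?B by (rule L.sigma_finite) simp
  interpret P: pair_sigma_finite ?A ?B ..
  let ?f = "\<lambda>u. \<Prod>i=1..N-1. F i (u i)" and ?g = "\<lambda>v. \<Prod>j=1..N. G j (v j)"
  have f: "integrable ?A ?f" using F by (intro L.product_integrable_prod) auto
  have g: "integrable ?B ?g" using G by (intro L.product_integrable_prod) auto
  have int: "integrable (?A \<Otimes>\<^sub>M ?B) (\<lambda>w. ?f (fst w) * ?g (snd w))"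
  proof (rule P.Fubini_integrable)
    show "(\<lambda>w. ?f (fst w) * ?g (snd w)) \<in> borel_measurable (?A \<Otimes>\<^sub>M ?B)"
      using borel_measurable_integrable[OF f] borel_measurable_integrable[OF g] by measurable
    show "integrable ?A (\<lambda>x. \<integral>y. norm (?f (fst (x, y)) * ?g (snd (x, y))) \<partial>?B)"
      using f by (simp add: abs_mult)
    show "AE x in ?A. integrable ?B (\<lambda>y. ?f (fst (x, y)) * ?g (snd (x, y)))"
      using g by simp
  qed
  have "(\<integral>w. ?f (fst w) * ?g (snd w) \<partial>(?A \<Otimes>\<^sub>M ?B)) = (\<integral>u. (\<integral>v. ?f u * ?g v \<partial>?B) \<partial>?A)"
    using P.integral_fst'[OF int] by simp
  also have "\<dots> = (\<integral>u. ?f u \<partial>?A) * (\<integral>v. ?g v \<partial>?B)" by simp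
  also have "\<dots> = (\<Prod>i=1..N-1. integral\<^sup>L lborel (F i)) * (\<Prod>j=1..N. integral\<^sup>L lborel (G j))"
    by (intro arg_cong2[where f="(*)"] L.product_integral_prod finite_atLeastAtMost F G)
  finally show ?thesis using int by (simp add: has_bochner_integral_iff phase_lborel_def)
qed

text \<open>One index type for stretches and momenta makes the Gibbs state a single product of
  one-dimensional Gaussians.\<close>

definition coord :: "phase_point \<Rightarrow> nat + nat \<Rightarrow> real" where
  "coord w = case_sum (fst w) (snd w)"

definition sites :: "nat \<Rightarrow> (nat + nat) set" where
  "sites N = {1..N-1} <+> {1..N}"

lemma finite_sites [simp]: "finite (sites N)"
  by (simp add: sites_def)

lemma Inl_in_sites [simp]: "Inl x \<in> sites N \<longleftrightarrow> x \<in> {1..N-1}"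
  and Inr_in_sites [simp]: "Inr x \<in> sites N \<longleftrightarrow> x \<in> {1..N}"
  by (auto simp: sites_def)

lemma sum_sites: "(\<Sum>k\<in>sites N. h k) = (\<Sum>x=1..N-1. h (Inl x)) + (\<Sum>x=1..N. h (Inr x))" for h :: "nat + nat \<Rightarrow> real"
  unfolding sites_def by (subst sum.Plus) (auto simp: o_def)

lemma prod_sites: "(\<Prod>k\<in>sites N. h k) = (\<Prod>x=1..N-1. h (Inl x)) * (\<Prod>x=1..N. h (Inr x))" for h :: "nat + nat \<Rightarrow> real"
  unfolding sites_def by (subst prod.Plus) (auto simp: o_def)

lemma phase_integral_prod_sites:
  fixes F :: "nat + nat \<Rightarrow> real \<Rightarrow> real"
  assumes "\<And>k. k \<in> sites N \<Longrightarrow> integrable lborel (F k)"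
  shows "has_bochner_integral (phase_lborel N) (\<lambda>w. \<Prod>k\<in>sites N. F k (coord w k))
      (\<Prod>k\<in>sites N. integral\<^sup>L lborel (F k))"
  using phase_integral_prod[of N "\<lambda>i. F (Inl i)" "\<lambda>i. F (Inr i)"] assms
  by (simp add: prod_sites coord_def)

lemma measurable_coord:
  assumes "k \<in> sites N"
  shows "(\<lambda>w. coord w k) \<in> borel_measurable (phase_lborel N)"
  using assms unfolding sites_def coord_def phase_lborel_def by auto

definition gibbs_mean :: "nat \<Rightarrow> (real \<Rightarrow> real) \<Rightarrow> (real \<Rightarrow> real) \<Rightarrow> nat + nat \<Rightarrow> real" where
  "gibbs_mean N rini pini = case_sum (\<lambda>x. rini (real x / real N)) (\<lambda>x. pini (real x / real N))"

text \<open>The momentum exponent is \<open>\<beta> m (p/m - pini/m)^2 / 2 = (p - pini)^2 / (2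
  m/\<beta>)\<close>, whence the variance \<open>m/\<beta>\<close>.\<close>

definition gibbs_sd :: "real \<Rightarrow> real \<Rightarrow> nat + nat \<Rightarrow> real" where
  "gibbs_sd m \<beta> = case_sum (\<lambda>_. 1 / sqrt \<beta>) (\<lambda>_. sqrt (m / \<beta>))"

lemma gibbs_sd_pos: "m > 0 \<Longrightarrow> \<beta> > 0 \<Longrightarrow> gibbs_sd m \<beta> k > 0"
  by (auto simp: gibbs_sd_def split: sum.splits)

text \<open>The weight is a product of normal densities up to their constant prefactors
  \<open>C\<close>. Since the product of the densities has integral 1, this also determines the
  normalizing constant as \<open>1 / C\<close>.\<close>

lemma local_gibbs_eq_gaussian:
  fixes rini pini :: "real \<Rightarrow> real" and N :: nat and m \<beta> :: real
  assumes m: "m > 0" and \<beta>: "\<beta> > 0"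
  defines "\<phi> \<equiv> \<lambda>k. normal_density (gibbs_mean N rini pini k) (gibbs_sd m \<beta> k)"
  shows "local_gibbs N (\<lambda>_. m) m \<beta> rini pini
    = density (phase_lborel N) (\<lambda>w. ennreal (\<Prod>k\<in>sites N. \<phi> k (coord w k)))"
proof -
  define c where "c k = 1 / sqrt (2 * pi * (gibbs_sd m \<beta> k)\<^sup>2)" for k
  have c: "c k > 0" for k using gibbs_sd_pos[OF m \<beta>, of k] by (simp add: c_def)
  define C where "C = (\<Prod>k\<in>sites N. c k)"
  have C: "C > 0" unfolding C_def by (intro prod_pos c)
  have weight: "gibbs_weight N (\<lambda>_. m) m \<beta> rini pini w = (\<Prod>k\<in>sites N. \<phi> k (coord w k)) / C" for w
  proof -
    have "- \<beta> / 2 * (\<Sum>x=1..N. m * (snd w x / m - pini (real x / real N) / m)\<^sup>2)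
      - \<beta> / 2 * (\<Sum>x=1..N-1. (fst w x - rini (real x / real N))\<^sup>2)
      = (\<Sum>k\<in>sites N. - (coord w k - gibbs_mean N rini pini k)\<^sup>2 / (2 * (gibbs_sd m \<beta> k)\<^sup>2))"
    proof -
      have "- \<beta> / 2 * (m * (snd w x / m - pini (real x / real N) / m)\<^sup>2)
         = - (coord w (Inr x) - gibbs_mean N rini pini (Inr x))\<^sup>2 / (2 * (gibbs_sd m \<beta> (Inr x))\<^sup>2)" for x
        using m \<beta> by (simp add: coord_def gibbs_mean_def gibbs_sd_def power2_eq_square field_simps)
      then have 1: "- \<beta> / 2 * (\<Sum>x=1..N. m * (snd w x / m - pini (real x / real N) / m)\<^sup>2)
         = (\<Sum>x=1..N. - (coord w (Inr x) - gibbs_mean N rini pini (Inr x))\<^sup>2 / (2 * (gibbs_sd m \<beta> (Inr x))\<^sup>2))"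
        by (simp only: sum_distrib_left)
      have "- \<beta> / 2 * (fst w x - rini (real x / real N))\<^sup>2
         = - (coord w (Inl x) - gibbs_mean N rini pini (Inl x))\<^sup>2 / (2 * (gibbs_sd m \<beta> (Inl x))\<^sup>2)" for x
        using \<beta> by (simp add: coord_def gibbs_mean_def gibbs_sd_def power_divide)
      then have "- \<beta> / 2 * (\<Sum>x=1..N-1. (fst w x - rini (real x / real N))\<^sup>2)
         = (\<Sum>x=1..N-1. - (coord w (Inl x) - gibbs_mean N rini pini (Inl x))\<^sup>2 / (2 * (gibbs_sd m \<beta> (Inl x))\<^sup>2))"
        by (simp only: sum_distrib_left)
      with 1 show ?thesis unfolding sum_sites by linarith
    qed
    then have "gibbs_weight N (\<lambda>_. m) m \<beta> rini pini w =
       (\<Prod>k\<in>sites N. exp (- (coord w k - gibbs_mean N rini pini k)\<^sup>2 / (2 * (gibbs_sd m \<beta> k)\<^sup>2)))"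
      unfolding gibbs_weight_def by (simp add: exp_sum)
    also have "\<dots> = (\<Prod>k\<in>sites N. \<phi> k (coord w k) / c k)"
      using c by (intro prod.cong refl) (simp add: \<phi>_def normal_density_def c_def[symmetric] less_imp_neq[symmetric])
    finally show ?thesis by (simp add: prod_dividef C_def)
  qed
  have "has_bochner_integral (phase_lborel N) (\<lambda>w. \<Prod>k\<in>sites N. \<phi> k (coord w k)) (\<Prod>k\<in>sites N. integral\<^sup>L lborel (\<phi> k))"
    unfolding \<phi>_def by (intro phase_integral_prod_sites integrable_normal_density gibbs_sd_pos m \<beta>)
  then have "(\<integral>w. (\<Prod>k\<in>sites N. \<phi> k (coord w k)) \<partial>phase_lborel N) = 1"
    using gibbs_sd_pos[OF m \<beta>] by (simp add: has_bochner_integral_iff \<phi>_def)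
  then have Z: "gibbs_Z N (\<lambda>_. m) m \<beta> rini pini = 1 / C"
    unfolding gibbs_Z_def weight by simp
  show ?thesis unfolding local_gibbs_def weight Z using C by simp
qed

text \<open>Independence of the coordinates: the density is a product, so expectations of products
  of one-site functions factorize. All moments needed later are instances with
  \<open>F k = 1\<close> at all but one or two sites.\<close>

lemma gibbs_product_moment:
  fixes rini pini :: "real \<Rightarrow> real" and N :: nat and m \<beta> :: real
    and F :: "nat + nat \<Rightarrow> real \<Rightarrow> real"
  assumes m: "m > 0" and \<beta>: "\<beta> > 0"
  defines "\<phi> \<equiv> \<lambda>k. normal_density (gibbs_mean N rini pini k) (gibbs_sd m \<beta> k)"
  assumes meas: "\<And>k. F k \<in> borel_measurable borel"
    and F: "\<And>k. has_bochner_integral lborel (\<lambda>x. \<phi> k x * F k x) (I k)"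
  shows "has_bochner_integral (local_gibbs N (\<lambda>_. m) m \<beta> rini pini)
     (\<lambda>w. \<Prod>k\<in>sites N. F k (coord w k)) (\<Prod>k\<in>sites N. I k)"
proof -
  have eq: "local_gibbs N (\<lambda>_. m) m \<beta> rini pini
      = density (phase_lborel N) (\<lambda>w. ennreal (\<Prod>k\<in>sites N. \<phi> k (coord w k)))"
    unfolding \<phi>_def by (rule local_gibbs_eq_gaussian[OF m \<beta>])
  show ?thesis unfolding eq
  proof (rule has_bochner_integral_density)
  show "(\<lambda>w. \<Prod>k\<in>sites N. F k (coord w k)) \<in> borel_measurable (phase_lborel N)"
    by (intro borel_measurable_prod measurable_compose[OF measurable_coord meas])
  have "\<phi> k \<in> borel_measurable borel" for k unfolding \<phi>_def by measurable
  then show "(\<lambda>w. \<Prod>k\<in>sites N. \<phi> k (coord w k)) \<in> borel_measurable (phase_lborel N)"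
    by (intro borel_measurable_prod measurable_compose[OF measurable_coord])
  show "AE w in phase_lborel N. 0 \<le> (\<Prod>k\<in>sites N. \<phi> k (coord w k))"
    unfolding \<phi>_def by (intro AE_I2 prod_nonneg normal_density_nonneg)
  have "has_bochner_integral (phase_lborel N) (\<lambda>w. \<Prod>k\<in>sites N. \<phi> k (coord w k) * F k (coord w k))
     (\<Prod>k\<in>sites N. integral\<^sup>L lborel (\<lambda>x. \<phi> k x * F k x))"
    by (rule phase_integral_prod_sites) (use F in \<open>auto simp: has_bochner_integral_iff\<close>)
  then show "has_bochner_integral (phase_lborel N)
     (\<lambda>w. (\<Prod>k\<in>sites N. \<phi> k (coord w k)) *\<^sub>R (\<Prod>k\<in>sites N. F k (coord w k))) (\<Prod>k\<in>sites N. I k)"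
    using F by (simp add: prod.distrib has_bochner_integral_integral_eq[OF F])
  qed
qed

lemma gibbs_centred_moments:
  fixes rini pini :: "real \<Rightarrow> real" and N :: nat and m \<beta> :: real
  assumes m: "m > 0" and \<beta>: "\<beta> > 0"
  defines "M \<equiv> local_gibbs N (\<lambda>_. m) m \<beta> rini pini" and "\<mu> \<equiv> gibbs_mean N rini pini"
    and "\<sigma> \<equiv> gibbs_sd m \<beta>"
  shows "has_bochner_integral M (\<lambda>_. 1) (1 :: real)"
    and "a \<in> sites N \<Longrightarrow> has_bochner_integral M (\<lambda>w. coord w a - \<mu> a) 0"
    and "a \<in> sites N \<Longrightarrow> b \<in> sites N \<Longrightarrow>
      has_bochner_integral M (\<lambda>w. (coord w a - \<mu> a) * (coord w b - \<mu> b)) (if a = b then (\<sigma> a)\<^sup>2 else 0)"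
proof -
  note pos = gibbs_sd_pos[OF m \<beta>, folded \<sigma>_def]
  let ?\<phi> = "\<lambda>k. normal_density (\<mu> k) (\<sigma> k)"
  have n0: "has_bochner_integral lborel (?\<phi> k) 1" for k
    using normal_moment_even[OF pos[of k], where k=0] by simp
  have n1: "has_bochner_integral lborel (\<lambda>x. ?\<phi> k x * (x - \<mu> k)) 0" for k
    using normal_moment_odd[OF pos[of k], where k=0] by simp
  have n2: "has_bochner_integral lborel (\<lambda>x. ?\<phi> k x * ((x - \<mu> k) * (x - \<mu> k))) ((\<sigma> k)\<^sup>2)" for k
    using normal_moment_even[OF pos[of k], where k=1] by (simp add: power2_eq_square fact_numeral)
  note moment = gibbs_product_moment[OF m \<beta>, where N=N and rini=rini and pini=pini, folded M_def \<mu>_def \<sigma>_def]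
  show "has_bochner_integral M (\<lambda>_. 1) (1 :: real)"
    using moment[of "\<lambda>_ _. 1" "\<lambda>_. 1"] n0 by simp
  show "has_bochner_integral M (\<lambda>w. coord w a - \<mu> a) 0" if "a \<in> sites N"
  proof -
    have "has_bochner_integral M (\<lambda>w. \<Prod>k\<in>sites N. if k = a then coord w k - \<mu> k else 1)
       (\<Prod>k\<in>sites N. if k = a then 0 else 1)"
      by (rule moment[where F="\<lambda>k x. if k = a then x - \<mu> k else 1"]) (auto simp: n0 n1)
    then show ?thesis using that by (simp add: prod.delta)
  qed
  show "has_bochner_integral M (\<lambda>w. (coord w a - \<mu> a) * (coord w b - \<mu> b)) (if a = b then (\<sigma> a)\<^sup>2 else 0)"
    if ab: "a \<in> sites N" "b \<in> sites N"
  proof -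
    \<comment> \<open>Keeping one factor for \<open>a\<close> and one for \<open>b\<close> treats
      both cases at once: if the sites coincide, the factors combine to a variance; otherwise a
      centred first moment makes the product vanish.\<close>
    let ?I = "\<lambda>k. if k = a \<and> k = b then (\<sigma> k)\<^sup>2 else if k = a \<or> k = b then 0 else 1"
    have "has_bochner_integral M (\<lambda>w. \<Prod>k\<in>sites N. (if k = a then coord w k - \<mu> k else 1) * (if k = b then coord w k - \<mu> k else 1))
       (\<Prod>k\<in>sites N. ?I k)"
      by (rule moment[where F="\<lambda>k x. (if k = a then x - \<mu> k else 1) * (if k = b then x - \<mu> k else 1)"])
         (auto simp: n0 n1 n2)
    moreover have "(\<Prod>k\<in>sites N. ?I k) = (if a = b then (\<sigma> a)\<^sup>2 else 0)"
    proof (cases "a = b")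
      case True
      then have "(\<Prod>k\<in>sites N. ?I k) = (\<Prod>k\<in>sites N. if k = a then (\<sigma> k)\<^sup>2 else 1)"
        by (intro prod.cong) auto
      with True ab show ?thesis by (simp add: prod.delta)
    next
      case False
      with ab show ?thesis by (auto intro!: prod_zero)
    qed
    ultimately show ?thesis using ab by (simp add: prod.distrib prod.delta)
  qed
qed

text \<open>After centring, the covariance is diagonal, so the double sum for the variance collapses
  to its diagonal.\<close>

lemma gibbs_linear_moments:
  fixes rini pini :: "real \<Rightarrow> real" and N :: nat and m \<beta> :: real
  assumes m: "m > 0" and \<beta>: "\<beta> > 0"
  defines "M \<equiv> local_gibbs N (\<lambda>_. m) m \<beta> rini pini" and "\<mu> \<equiv> gibbs_mean N rini pini"
    and "\<sigma> \<equiv> gibbs_sd m \<beta>"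
  shows "has_bochner_integral M (\<lambda>w. \<Sum>k\<in>sites N. g k * coord w k) (\<Sum>k\<in>sites N. g k * \<mu> k)"
    and "has_bochner_integral M (\<lambda>w. (\<Sum>k\<in>sites N. g k * coord w k)\<^sup>2)
      ((\<Sum>k\<in>sites N. g k * \<mu> k)\<^sup>2 + (\<Sum>k\<in>sites N. (g k)\<^sup>2 * (\<sigma> k)\<^sup>2))"
proof -
  note mom = gibbs_centred_moments[OF m \<beta>, where N=N and rini=rini and pini=pini, folded M_def \<mu>_def \<sigma>_def]
  define c where "c = (\<Sum>k\<in>sites N. g k * \<mu> k)"
  define Y where "Y w = (\<Sum>k\<in>sites N. g k * (coord w k - \<mu> k))" for w
  \<comment> \<open>The mean is kept as a multiple of the constant 1, whose expectation is the
    normalization of the measure.\<close>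
  have L: "(\<Sum>k\<in>sites N. g k * coord w k) = c * 1 + Y w" for w
    unfolding c_def Y_def by (simp add: sum.distrib[symmetric] algebra_simps)
  have Y: "has_bochner_integral M Y (\<Sum>k\<in>sites N. g k * 0)"
    unfolding Y_def by (intro has_bochner_integral_sum has_bochner_integral_mult_right mom)
  have YY: "has_bochner_integral M (\<lambda>w. \<Sum>k\<in>sites N. \<Sum>l\<in>sites N. (g k * g l) * ((coord w k - \<mu> k) * (coord w l - \<mu> l)))
      (\<Sum>k\<in>sites N. \<Sum>l\<in>sites N. (g k * g l) * (if k = l then (\<sigma> k)\<^sup>2 else 0))"
    by (intro has_bochner_integral_sum has_bochner_integral_mult_right mom)
  have Y2: "(\<Sum>k\<in>sites N. \<Sum>l\<in>sites N. (g k * g l) * ((coord w k - \<mu> k) * (coord w l - \<mu> l))) = (Y w)\<^sup>2" for w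
    unfolding Y_def power2_eq_square sum_product by (simp add: mult_ac)
  have S2: "(\<Sum>k\<in>sites N. \<Sum>l\<in>sites N. (g k * g l) * (if k = l then (\<sigma> k)\<^sup>2 else 0)) = (\<Sum>k\<in>sites N. (g k)\<^sup>2 * (\<sigma> k)\<^sup>2)"
    by (simp add: if_distrib[of "\<lambda>u. _ * u"] sum.delta power2_eq_square cong: if_cong)
  have "has_bochner_integral M (\<lambda>w. c * 1 + Y w) (c * 1 + (\<Sum>k\<in>sites N. g k * 0))"
    by (intro has_bochner_integral_add has_bochner_integral_mult_right mom Y)
  then show "has_bochner_integral M (\<lambda>w. \<Sum>k\<in>sites N. g k * coord w k) (\<Sum>k\<in>sites N. g k * \<mu> k)"
    unfolding L c_def[symmetric] by simp
  have "has_bochner_integral M (\<lambda>w. c\<^sup>2 * 1 + 2 * c * Y w + (Y w)\<^sup>2)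
     (c\<^sup>2 * 1 + 2 * c * (\<Sum>k\<in>sites N. g k * 0) + (\<Sum>k\<in>sites N. (g k)\<^sup>2 * (\<sigma> k)\<^sup>2))"
    by (intro has_bochner_integral_add has_bochner_integral_mult_right mom Y YY[unfolded Y2 S2])
  then show "has_bochner_integral M (\<lambda>w. (\<Sum>k\<in>sites N. g k * coord w k)\<^sup>2)
      ((\<Sum>k\<in>sites N. g k * \<mu> k)\<^sup>2 + (\<Sum>k\<in>sites N. (g k)\<^sup>2 * (\<sigma> k)\<^sup>2))"
    unfolding L c_def[symmetric] by (simp add: power2_sum add_ac mult_ac)
qed

section \<open>Linear observables and the moments at later times\<close>

text \<open>Points of the product space are undefined off their index sets, hence
  \<open>restrict\<close>: solutions are given only for starting points in that space, and this must
  be one of them.\<close>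

definition mean_point :: "nat \<Rightarrow> (real \<Rightarrow> real) \<Rightarrow> (real \<Rightarrow> real) \<Rightarrow> phase_point" where
  "mean_point N rini pini =
     (restrict (\<lambda>x. rini (real x / real N)) {1..N-1}, restrict (\<lambda>x. pini (real x / real N)) {1..N})"

lemma space_phase_lborel: "space (phase_lborel N) = ({1..N-1} \<rightarrow>\<^sub>E UNIV) \<times> ({1..N} \<rightarrow>\<^sub>E UNIV)"
  by (simp add: phase_lborel_def space_pair_measure space_PiM)

lemma mean_point_in_space: "mean_point N rini pini \<in> space (phase_lborel N)"
  by (auto simp: mean_point_def space_phase_lborel)

lemma coord_mean_point:
  "k \<in> sites N \<Longrightarrow> coord (mean_point N rini pini) k = gibbs_mean N rini pini k"
  by (auto simp: mean_point_def coord_def gibbs_mean_def sites_def)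

text \<open>Expectation commutes with a linear functional, so the mean is its value at the mean
  point; for the dynamics this says that the averaged trajectory is the trajectory of the averaged
  data. The coefficients survive only in the variance \<open>V\<close>.\<close>

lemma gibbs_moments_of_linear_observable:
  assumes m: "m > 0" and \<beta>: "\<beta> > 0"
    and X: "\<And>w. w \<in> space (phase_lborel N) \<Longrightarrow> X w = (\<Sum>k\<in>sites N. g k * coord w k)"
    and V: "(\<Sum>k\<in>sites N. (g k)\<^sup>2 * (gibbs_sd m \<beta> k)\<^sup>2) = V"
  shows "has_bochner_integral (local_gibbs N (\<lambda>_. m) m \<beta> rini pini) X (X (mean_point N rini pini))"
    and "has_bochner_integral (local_gibbs N (\<lambda>_. m) m \<beta> rini pini) (\<lambda>w. (X w)\<^sup>2) ((X (mean_point N rini pini))\<^sup>2 + V)"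
proof -
  let ?M = "local_gibbs N (\<lambda>_. m) m \<beta> rini pini"
  have sp: "space ?M = space (phase_lborel N)" by (simp add: local_gibbs_def)
  have mean: "X (mean_point N rini pini) = (\<Sum>k\<in>sites N. g k * gibbs_mean N rini pini k)"
    by (simp add: X mean_point_in_space coord_mean_point)
  show "has_bochner_integral ?M X (X (mean_point N rini pini))"
    unfolding mean using gibbs_linear_moments(1)[OF m \<beta>]
    by (rule has_bochner_integral_cong[THEN iffD2, rotated 3]) (auto simp: sp X)
  show "has_bochner_integral ?M (\<lambda>w. (X w)\<^sup>2) ((X (mean_point N rini pini))\<^sup>2 + V)"
    unfolding mean V[symmetric] using gibbs_linear_moments(2)[OF m \<beta>]
    by (rule has_bochner_integral_cong[THEN iffD2, rotated 3]) (auto simp: sp X)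
qed

definition basis_point :: "nat \<Rightarrow> nat + nat \<Rightarrow> phase_point" where
  "basis_point N a = (restrict (\<lambda>x. if a = Inl x then 1 else 0) {1..N-1},
                      restrict (\<lambda>x. if a = Inr x then 1 else 0) {1..N})"

lemma basis_point_in_space: "basis_point N a \<in> space (phase_lborel N)"
  by (auto simp: basis_point_def space_phase_lborel)

text \<open>By reciprocity, \<open>r\<^sub>x(s)\<close> is a linear functional of the initial state whose coefficients form
  the solution started from a unit vector; its variance is therefore a conserved energy.\<close>

lemma chain_gibbs_moments:
  fixes rini pini :: "real \<Rightarrow> real" and N :: nat and m \<beta> :: real
    and R P :: "phase_point \<Rightarrow> real \<Rightarrow> nat \<Rightarrow> real" and s :: real
  assumes m: "m > 0" and \<beta>: "\<beta> > 0" and N: "N \<ge> 1" and s: "s \<ge> 0"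
    and sol: "\<forall>w\<in>space (phase_lborel N). chain_solution N (\<lambda>_. m) w (R w) (P w)"
  defines "M \<equiv> local_gibbs N (\<lambda>_. m) m \<beta> rini pini" and "w0 \<equiv> mean_point N rini pini"
  shows "x \<in> {1..N-1} \<Longrightarrow> has_bochner_integral M (\<lambda>w. R w s x) (R w0 s x)"
    and "x \<in> {1..N-1} \<Longrightarrow> has_bochner_integral M (\<lambda>w. (R w s x)\<^sup>2) ((R w0 s x)\<^sup>2 + 1 / \<beta>)"
    and "x \<in> {1..N} \<Longrightarrow> has_bochner_integral M (\<lambda>w. P w s x) (P w0 s x)"
    and "x \<in> {1..N} \<Longrightarrow> has_bochner_integral M (\<lambda>w. (P w s x)\<^sup>2) ((P w0 s x)\<^sup>2 + m / \<beta>)"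
proof -
  note sol = sol[rule_format]
  have m0: "m \<noteq> 0" using m by simp
  define r p where "r a = R (basis_point N a) s" and "p a = P (basis_point N a) s" for a
  note sol_a = sol[OF basis_point_in_space]
  have energy: "(\<Sum>x=1..N-1. (r a x)\<^sup>2) + (\<Sum>x=1..N. (p a x)\<^sup>2) / m = (if a \<in> range Inl then 1 else 1 / m)"
    if "a \<in> sites N" for a
    using chain_energy_conservation[OF N m0 s sol_a, of a] that
    by (auto simp: r_def p_def basis_point_def sites_def if_distrib[of "\<lambda>u. u\<^sup>2"] cong: if_cong)
  {
    assume x: "x \<in> {1..N-1}"
    \<comment> \<open>Read off from reciprocity with the unit stretch at \<open>x\<close>, whose
      pairing isolates \<open>R w s x\<close>; the sign and the factor \<open>1 / m\<close> belong
      to the twisted form.\<close>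
    define g where "g = case_sum (r (Inl x)) (\<lambda>y. - p (Inl x) y / m)"
    have lin: "R w s x = (\<Sum>k\<in>sites N. g k * coord w k)" if "w \<in> space (phase_lborel N)" for w
      using chain_reciprocity[OF N m0 s sol[OF that] sol_a, of "Inl x"] x
      by (simp add: basis_point_def if_distrib[of "\<lambda>u. _ * u"] sum_sites g_def coord_def r_def p_def
          sum_divide_distrib sum_negf mult.commute cong: if_cong)
    \<comment> \<open>The squared coefficient \<open>(p/m)^2\<close> times the variance
      \<open>m/\<beta>\<close> is \<open>p^2/(m \<beta>)\<close>: equipartition turns the variance
      into the conserved form divided by \<open>\<beta>\<close>.\<close>
    have "(\<Sum>k\<in>sites N. (g k)\<^sup>2 * (gibbs_sd m \<beta> k)\<^sup>2)
        = ((\<Sum>y=1..N-1. (r (Inl x) y)\<^sup>2) + (\<Sum>y=1..N. (p (Inl x) y)\<^sup>2) / m) / \<beta>"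
      using m \<beta> by (simp add: sum_sites g_def gibbs_sd_def sum_divide_distrib add_divide_distrib power_divide power2_eq_square)
    then have V: "(\<Sum>k\<in>sites N. (g k)\<^sup>2 * (gibbs_sd m \<beta> k)\<^sup>2) = 1 / \<beta>"
      using energy[of "Inl x"] x by simp
    show "has_bochner_integral M (\<lambda>w. R w s x) (R w0 s x)"
      and "has_bochner_integral M (\<lambda>w. (R w s x)\<^sup>2) ((R w0 s x)\<^sup>2 + 1 / \<beta>)"
      unfolding M_def w0_def by (rule gibbs_moments_of_linear_observable[where X="\<lambda>w. R w s x", OF m \<beta> lin V], assumption)+
  }
  {
    assume x: "x \<in> {1..N}"
    \<comment> \<open>A unit momentum isolates \<open>- P w s x / m\<close> instead, so all
      coefficients are multiplied by \<open>- m\<close>.\<close>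
    define g where "g = case_sum (\<lambda>y. - m * r (Inr x) y) (p (Inr x))"
    have lin: "P w s x = (\<Sum>k\<in>sites N. g k * coord w k)" if "w \<in> space (phase_lborel N)" for w
    proof -
      have "- P w s x / m = (\<Sum>y=1..N-1. fst w y * r (Inr x) y) - (\<Sum>y=1..N. snd w y * p (Inr x) y) / m"
        using chain_reciprocity[OF N m0 s sol[OF that] sol_a, of "Inr x"] x
        by (simp add: basis_point_def if_distrib[of "\<lambda>u. _ * u"] r_def p_def cong: if_cong)
      then have "P w s x = - m * (\<Sum>y=1..N-1. fst w y * r (Inr x) y) + (\<Sum>y=1..N. snd w y * p (Inr x) y)"
        using m by (simp add: field_simps)
      then show ?thesis
        by (simp add: sum_sites g_def coord_def sum_distrib_left sum_negf mult_ac)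
    qed
    let ?A = "\<Sum>y=1..N-1. (r (Inr x) y)\<^sup>2" and ?B = "\<Sum>y=1..N. (p (Inr x) y)\<^sup>2"
    have "(\<Sum>k\<in>sites N. (g k)\<^sup>2 * (gibbs_sd m \<beta> k)\<^sup>2) = m\<^sup>2 / \<beta> * ?A + m / \<beta> * ?B"
      using m \<beta> by (simp add: sum_sites g_def gibbs_sd_def power_mult_distrib power_divide sum_distrib_left mult_ac)
    also have "\<dots> = m\<^sup>2 / \<beta> * (?A + ?B / m)"
      using m \<beta> by (simp add: field_simps power2_eq_square)
    also have "?A + ?B / m = 1 / m" using energy[of "Inr x"] x by auto
    finally have V: "(\<Sum>k\<in>sites N. (g k)\<^sup>2 * (gibbs_sd m \<beta> k)\<^sup>2) = m / \<beta>"
      using m by (simp add: power2_eq_square)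
    show "has_bochner_integral M (\<lambda>w. P w s x) (P w0 s x)"
      and "has_bochner_integral M (\<lambda>w. (P w s x)\<^sup>2) ((P w0 s x)\<^sup>2 + m / \<beta>)"
      unfolding M_def w0_def by (rule gibbs_moments_of_linear_observable[where X="\<lambda>w. P w s x", OF m \<beta> lin V], assumption)+
  }
qed

subsection \<open>Riemann averages\<close>

text \<open>By uniform continuity each cell of length \<open>1/N\<close> contributes an error of at
  most \<open>\<epsilon> / (2 N)\<close>.\<close>

lemma riemann_sums_converge:
  fixes g :: "real \<Rightarrow> real"
  assumes g: "continuous_on {0..1} g"
  shows "(\<lambda>N. 1 / real N * (\<Sum>x=1..N. g (real x / real N))) \<longlonglongrightarrow> integral {0..1} g"
proof (rule LIMSEQ_I)
  fix \<epsilon> :: real assume \<epsilon>: "\<epsilon> > 0"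
  have "uniformly_continuous_on {0..1} g"
    using g by (intro compact_uniformly_continuous) auto
  then obtain d where d: "d > 0" "\<And>y z. y \<in> {0..1} \<Longrightarrow> z \<in> {0..1} \<Longrightarrow> dist z y < d \<Longrightarrow> dist (g z) (g y) < \<epsilon> / 2"
    unfolding uniformly_continuous_on_def using \<epsilon> half_gt_zero by metis
  obtain n where n: "1 / real (Suc n) < d"
    using reals_Archimedean[OF d(1)] by (auto simp: inverse_eq_divide)
  have "norm (1 / real N * (\<Sum>x=1..N. g (real x / real N)) - integral {0..1} g) < \<epsilon>" if "N \<ge> Suc n" for N
  proof -
    have "1 / real N \<le> 1 / real (Suc n)" using that by (intro frac_le) auto
    then have N: "N > 0" "1 / real N < d" using n that by auto
    \<comment> \<open>Stated for the first \<open>k\<close> cells, so that the induction adds one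
      cell at a time; \<open>k = N\<close> is the claim.\<close>
    have "\<bar>(\<Sum>x=1..k. g (real x / real N) / real N) - integral {0..real k / real N} g\<bar> \<le> real k * (\<epsilon> / 2 / real N)"
      if "k \<le> N" for k
      using that
    proof (induction k)
      case 0
      show ?case by simp
    next
      case (Suc k)
      let ?a = "real k / real N" and ?b = "real (Suc k) / real N"
      have ab: "0 \<le> ?a" "?a \<le> ?b" "?b \<le> 1" "?b - ?a = 1 / real N"
        using Suc.prems N by (auto simp: divide_right_mono field_simps)
      have int: "g integrable_on {u..v}" if "0 \<le> u" "v \<le> 1" for u v
        using that by (intro integrable_continuous_real continuous_on_subset[OF g]) auto
      have "integral {0..?a} g + integral {?a..?b} g = integral {0..?b} g"
        using ab by (intro Henstock_Kurzweil_Integration.integral_combine int) auto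
      moreover have "\<bar>g ?b / real N - integral {?a..?b} g\<bar> \<le> \<epsilon> / 2 / real N"
      proof -
        have "((\<lambda>y. g ?b - g y) has_integral (?b - ?a) * g ?b - integral {?a..?b} g) {?a..?b}"
          using has_integral_const_real[of "g ?b" ?a ?b] ab int[of ?a ?b]
          by (intro has_integral_diff integrable_integral) auto
        then have "norm ((?b - ?a) * g ?b - integral {?a..?b} g) \<le> \<epsilon> / 2 * measure lborel (cbox ?a ?b)"
        proof (intro has_integral_bound[where f="\<lambda>y. g ?b - g y"])
          show "norm (g ?b - g y) \<le> \<epsilon> / 2" if "y \<in> cbox ?a ?b" for y
          proof -
            have "dist ?b y < d" using that ab N by (auto simp: dist_real_def)
            moreover have "y \<in> {0..1}" "?b \<in> {0..1}"
              using that ab(1-3) unfolding cbox_interval atLeastAtMost_iff by linarith+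
            ultimately have "dist (g ?b) (g y) < \<epsilon> / 2" by (intro d(2))
            then show ?thesis by (simp add: dist_real_def)
          qed
        qed (use \<epsilon> in auto)
        then show ?thesis using ab by simp
      qed
      moreover have "real (Suc k) * (\<epsilon> / 2 / real N) = real k * (\<epsilon> / 2 / real N) + \<epsilon> / 2 / real N"
        by (simp add: distrib_right add_divide_distrib)
      ultimately show ?case using Suc.IH Suc.prems by simp
    qed
    from this[of N] N \<epsilon> show ?thesis by (simp add: sum_divide_distrib)
  qed
  then show "\<exists>n. \<forall>N\<ge>n. norm (1 / real N * (\<Sum>x=1..N. g (real x / real N)) - integral {0..1} g) < \<epsilon>"
    by blast
qed

section \<open>Weak and strong convergence of discrete profiles\<close>

lemma average_Cauchy_Schwarz:
  fixes u v :: "nat \<Rightarrow> real"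
  shows "\<bar>1 / real N * (\<Sum>x=1..N. u x * v x)\<bar>
     \<le> sqrt (1 / real N * (\<Sum>x=1..N. (u x)\<^sup>2)) * sqrt (1 / real N * (\<Sum>x=1..N. (v x)\<^sup>2))"
proof -
  have "(\<Sum>x=1..N. u x * v x)\<^sup>2 \<le> (\<Sum>x=1..N. (u x)\<^sup>2) * (\<Sum>x=1..N. (v x)\<^sup>2)"
    by (rule Cauchy_Schwarz_ineq_sum)
  then have "\<bar>\<Sum>x=1..N. u x * v x\<bar> \<le> sqrt ((\<Sum>x=1..N. (u x)\<^sup>2) * (\<Sum>x=1..N. (v x)\<^sup>2))"
    by (rule real_le_rsqrt[of "\<bar>_\<bar>", simplified])
  then have "1 / real N * \<bar>\<Sum>x=1..N. u x * v x\<bar> \<le> 1 / real N * sqrt ((\<Sum>x=1..N. (u x)\<^sup>2) * (\<Sum>x=1..N. (v x)\<^sup>2))"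
    by (rule mult_left_mono) simp
  also have "\<dots> = sqrt (1 / real N * (\<Sum>x=1..N. (u x)\<^sup>2)) * sqrt (1 / real N * (\<Sum>x=1..N. (v x)\<^sup>2))"
    by (simp add: real_sqrt_mult real_sqrt_divide)
  finally show ?thesis by (simp add: abs_mult)
qed

lemma average_of_squares_nonneg: "0 \<le> 1 / real N * (\<Sum>x=1..N. (u x)\<^sup>2)"
  for u :: "nat \<Rightarrow> real"
  by (intro mult_nonneg_nonneg sum_nonneg) auto

lemma average_product_tendsto_zero:
  fixes u d :: "nat \<Rightarrow> nat \<Rightarrow> real"
  assumes bound: "\<forall>\<^sub>F N in sequentially. 1 / real N * (\<Sum>x=1..N. (u N x)\<^sup>2) \<le> C"
    and d: "(\<lambda>N. 1 / real N * (\<Sum>x=1..N. (d N x)\<^sup>2)) \<longlonglongrightarrow> 0"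
  shows "(\<lambda>N. 1 / real N * (\<Sum>x=1..N. u N x * d N x)) \<longlonglongrightarrow> 0"
proof (rule Lim_null_comparison)
  show "\<forall>\<^sub>F N in sequentially. norm (1 / real N * (\<Sum>x=1..N. u N x * d N x))
      \<le> sqrt C * sqrt (1 / real N * (\<Sum>x=1..N. (d N x)\<^sup>2))"
    using bound
  proof eventually_elim
    case (elim N)
    have "sqrt (1 / real N * (\<Sum>x=1..N. (u N x)\<^sup>2)) * sqrt (1 / real N * (\<Sum>x=1..N. (d N x)\<^sup>2))
        \<le> sqrt C * sqrt (1 / real N * (\<Sum>x=1..N. (d N x)\<^sup>2))"
      by (intro mult_right_mono real_sqrt_le_mono real_sqrt_ge_zero average_of_squares_nonneg elim)
    then show ?case
      using average_Cauchy_Schwarz[of N "u N" "d N"] by (simp only: real_norm_def)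
  qed
  show "(\<lambda>N. sqrt C * sqrt (1 / real N * (\<Sum>x=1..N. (d N x)\<^sup>2))) \<longlonglongrightarrow> 0"
    using tendsto_mult_left[OF tendsto_real_sqrt[OF d], of "sqrt C"] by simp
qed

text \<open>A bounded sequence that converges against every mode converges against whatever the
  modes approximate in L2. The approximation is applied to the test function \<open>f\<close>; its
  error is paired with \<open>v\<close> and with \<open>h\<close>, whose norms are bounded.\<close>

lemma weak_convergence_of_dense:
  fixes v :: "nat \<Rightarrow> nat \<Rightarrow> real" and \<phi> :: "nat \<Rightarrow> real \<Rightarrow> real"
  assumes bound: "\<forall>\<^sub>F N in sequentially. 1 / real N * (\<Sum>x=1..N. (v N x)\<^sup>2) \<le> C"
    and \<phi>: "\<And>k. continuous_on {0..1} (\<phi> k)"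
    and h: "continuous_on {0..1} h" and f: "continuous_on {0..1} f"
    and modes: "\<And>k. (\<lambda>N. 1 / real N * (\<Sum>x=1..N. v N x * \<phi> k (real x / real N))) \<longlonglongrightarrow> integral {0..1} (\<lambda>y. h y * \<phi> k y)"
    and dense: "\<And>\<epsilon>. \<epsilon> > 0 \<Longrightarrow> \<exists>K c. integral {0..1} (\<lambda>y. (f y - (\<Sum>k<K. c k * \<phi> k y))\<^sup>2) < \<epsilon>"
  shows "(\<lambda>N. 1 / real N * (\<Sum>x=1..N. v N x * f (real x / real N))) \<longlonglongrightarrow> integral {0..1} (\<lambda>y. h y * f y)"
proof (rule LIMSEQ_I)
  fix \<epsilon> :: real assume \<epsilon>: "\<epsilon> > 0"
  \<comment> \<open>One bound for the discrete norms and for the norm of the limit; adding 1 makes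
    it positive, so that it can be divided by.\<close>
  define D where "D = max C (integral {0..1} (\<lambda>y. (h y)\<^sup>2)) + 1"
  have D: "D > 0" "C \<le> D" "integral {0..1} (\<lambda>y. (h y)\<^sup>2) \<le> D"
  proof -
    have "0 \<le> integral {0..1} (\<lambda>y. (h y)\<^sup>2)"
      by (intro integral_nonneg integrable_continuous_real continuous_intros h) auto
    then show "D > 0" "C \<le> D" "integral {0..1} (\<lambda>y. (h y)\<^sup>2) \<le> D" by (auto simp: D_def)
  qed
  \<comment> \<open>Chosen so that Cauchy-Schwarz bounds each pairing with the error
    \<open>f - q\<close> by \<open>sqrt D * sqrt \<delta> = \<epsilon> / 3\<close>.\<close>
  define \<delta> where "\<delta> = (\<epsilon> / 3)\<^sup>2 / D"
  have \<delta>: "\<delta> > 0" "sqrt D * sqrt \<delta> = \<epsilon> / 3"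
    using \<epsilon> D(1) by (auto simp: \<delta>_def real_sqrt_mult[symmetric])
  obtain K c where Kc: "integral {0..1} (\<lambda>y. (f y - (\<Sum>k<K. c k * \<phi> k y))\<^sup>2) < \<delta>"
    using dense[OF \<delta>(1)] by blast
  define q where "q y = (\<Sum>k<K. c k * \<phi> k y)" for y
  have q: "continuous_on {0..1} q" unfolding q_def by (intro continuous_intros \<phi>)
  let ?A = "\<lambda>N w. 1 / real N * (\<Sum>x=1..N. v N x * w (real x / real N))"
  have "(\<lambda>N. \<Sum>k<K. c k * ?A N (\<phi> k)) \<longlonglongrightarrow> (\<Sum>k<K. c k * integral {0..1} (\<lambda>y. h y * \<phi> k y))"
    by (intro tendsto_sum tendsto_mult_left modes)
  moreover have "(\<Sum>k<K. c k * ?A N (\<phi> k)) = ?A N q" for N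
    unfolding q_def sum_distrib_left by (subst sum.swap) (simp add: mult_ac)
  moreover have "((\<lambda>y. \<Sum>k<K. c k * (h y * \<phi> k y)) has_integral (\<Sum>k<K. c k * integral {0..1} (\<lambda>y. h y * \<phi> k y))) {0..1}"
    by (intro has_integral_sum has_integral_mult_right integrable_integral integrable_continuous_real continuous_intros h \<phi>) auto
  then have "(\<Sum>k<K. c k * integral {0..1} (\<lambda>y. h y * \<phi> k y)) = integral {0..1} (\<lambda>y. h y * q y)"
    unfolding q_def by (intro integral_unique[symmetric]) (simp add: sum_distrib_left mult.left_commute)
  ultimately have "(\<lambda>N. ?A N q) \<longlonglongrightarrow> integral {0..1} (\<lambda>y. h y * q y)" by simp
  from tendstoD[OF this, of "\<epsilon> / 3"] \<epsilon>
  have 1: "\<forall>\<^sub>F N in sequentially. \<bar>?A N q - integral {0..1} (\<lambda>y. h y * q y)\<bar> < \<epsilon> / 3"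
    by (simp add: dist_real_def del: less_divide_eq_numeral1)
  have "(\<lambda>N. 1 / real N * (\<Sum>x=1..N. (f (real x / real N) - q (real x / real N))\<^sup>2)) \<longlonglongrightarrow> integral {0..1} (\<lambda>y. (f y - q y)\<^sup>2)"
    by (rule riemann_sums_converge) (intro continuous_intros f q)
  then have 2: "\<forall>\<^sub>F N in sequentially. 1 / real N * (\<Sum>x=1..N. (f (real x / real N) - q (real x / real N))\<^sup>2) < \<delta>"
    using Kc unfolding q_def[symmetric] by (rule order_tendstoD(2))
  \<comment> \<open>Cauchy-Schwarz for integrals is obtained as the limit of its discrete version
    along Riemann sums.\<close>
  have 3: "\<bar>integral {0..1} (\<lambda>y. h y * (f y - q y))\<bar> \<le> \<epsilon> / 3"
  proof -
    have lim: "(\<lambda>N. \<bar>1 / real N * (\<Sum>x=1..N. h (real x / real N) * (f (real x / real N) - q (real x / real N)))\<bar>)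
        \<longlonglongrightarrow> \<bar>integral {0..1} (\<lambda>y. h y * (f y - q y))\<bar>"
      by (intro tendsto_rabs riemann_sums_converge continuous_intros h f q)
    have "(\<lambda>N. sqrt (1 / real N * (\<Sum>x=1..N. (h (real x / real N))\<^sup>2)) * sqrt (1 / real N * (\<Sum>x=1..N. (f (real x / real N) - q (real x / real N))\<^sup>2)))
       \<longlonglongrightarrow> sqrt (integral {0..1} (\<lambda>y. (h y)\<^sup>2)) * sqrt (integral {0..1} (\<lambda>y. (f y - q y)\<^sup>2))"
      by (intro tendsto_mult tendsto_real_sqrt riemann_sums_converge continuous_intros h f q)
    then have "\<bar>integral {0..1} (\<lambda>y. h y * (f y - q y))\<bar>
       \<le> sqrt (integral {0..1} (\<lambda>y. (h y)\<^sup>2)) * sqrt (integral {0..1} (\<lambda>y. (f y - q y)\<^sup>2))"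
      by (rule LIMSEQ_le[OF lim]) (intro exI allI impI average_Cauchy_Schwarz)
    also have "\<dots> \<le> sqrt D * sqrt \<delta>"
      using D Kc unfolding q_def[symmetric]
      by (intro mult_mono real_sqrt_le_mono real_sqrt_ge_zero integral_nonneg integrable_continuous_real continuous_intros f q) auto
    finally show ?thesis using \<delta>(2) by simp
  qed
  have hf: "integral {0..1} (\<lambda>y. h y * f y) = integral {0..1} (\<lambda>y. h y * q y) + integral {0..1} (\<lambda>y. h y * (f y - q y))"
  proof -
    have "((\<lambda>y. h y * q y + h y * (f y - q y)) has_integral
        integral {0..1} (\<lambda>y. h y * q y) + integral {0..1} (\<lambda>y. h y * (f y - q y))) {0..1}"
      by (intro has_integral_add integrable_integral integrable_continuous_real continuous_intros h f q)
    then show ?thesis by (intro integral_unique) (simp add: algebra_simps)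
  qed
  have "\<forall>\<^sub>F N in sequentially. norm (?A N f - integral {0..1} (\<lambda>y. h y * f y)) < \<epsilon>"
    using bound 1 2
  proof eventually_elim
    case (elim N)
    have "\<bar>1 / real N * (\<Sum>x=1..N. v N x * (f (real x / real N) - q (real x / real N)))\<bar> \<le>
      sqrt (1 / real N * (\<Sum>x=1..N. (v N x)\<^sup>2)) * sqrt (1 / real N * (\<Sum>x=1..N. (f (real x / real N) - q (real x / real N))\<^sup>2))"
      by (rule average_Cauchy_Schwarz)
    also have "\<dots> \<le> sqrt D * sqrt \<delta>"
      using elim(1,3) D(2)
      by (intro mult_mono real_sqrt_le_mono real_sqrt_ge_zero average_of_squares_nonneg)
         (use D(1) in \<open>auto intro: order_trans\<close>)
    also have "\<dots> = \<epsilon> / 3" by (rule \<delta>(2))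
    also have "1 / real N * (\<Sum>x=1..N. v N x * (f (real x / real N) - q (real x / real N))) = ?A N f - ?A N q"
      by (simp only: right_diff_distrib sum_subtractf)
    finally have "\<bar>?A N f - ?A N q\<bar> \<le> \<epsilon> / 3" .
    with elim(2) 3 hf show ?case by (simp only: real_norm_def)
  qed
  then show "\<exists>n. \<forall>N\<ge>n. norm (?A N f - integral {0..1} (\<lambda>y. h y * f y)) < \<epsilon>"
    by (simp only: eventually_sequentially)
qed

text \<open>With \<open>c = k pi / 2\<close> this turns the lattice frequency, multiplied by the
  time scale \<open>N\<close>, into the macroscopic one. The case split fixes the sign of
  \<open>c\<close> for the asymptotic expansion.\<close>

lemma discrete_frequency_limit:
  fixes c :: real
  shows "(\<lambda>N. real N * sin (c / real N)) \<longlonglongrightarrow> c"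
proof (cases "c = 0")
  case False
  then consider "c > 0" | "c < 0" by linarith
  then show ?thesis by cases real_asymp+
qed simp

text \<open>Expanding the square, weak convergence tested against the limit itself gives the cross
  term, and convergence of norms gives the rest. Norms converge only in the combination of both
  profiles, so the two defects are shown to vanish together and then separated by
  nonnegativity.\<close>

lemma strong_convergence_of_weak:
  fixes u v :: "nat \<Rightarrow> nat \<Rightarrow> real" and h k :: "real \<Rightarrow> real"
  assumes m: "m > 0" and h: "continuous_on {0..1} h" and k: "continuous_on {0..1} k"
    and u: "\<And>f. continuous_on {0..1} f \<Longrightarrow>
      (\<lambda>N. 1 / real N * (\<Sum>x=1..N. u N x * f (real x / real N))) \<longlonglongrightarrow> integral {0..1} (\<lambda>y. h y * f y)"
    and v: "\<And>f. continuous_on {0..1} f \<Longrightarrow>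
      (\<lambda>N. 1 / real N * (\<Sum>x=1..N. v N x * f (real x / real N))) \<longlonglongrightarrow> integral {0..1} (\<lambda>y. k y * f y)"
    and energy: "(\<lambda>N. 1 / real N * (\<Sum>x=1..N. (u N x)\<^sup>2) + 1 / real N * (\<Sum>x=1..N. (v N x)\<^sup>2) / m)
      \<longlonglongrightarrow> integral {0..1} (\<lambda>y. (h y)\<^sup>2) + integral {0..1} (\<lambda>y. (k y)\<^sup>2) / m"
  shows "(\<lambda>N. 1 / real N * (\<Sum>x=1..N. (u N x - h (real x / real N))\<^sup>2)) \<longlonglongrightarrow> 0"
    and "(\<lambda>N. 1 / real N * (\<Sum>x=1..N. (v N x - k (real x / real N))\<^sup>2)) \<longlonglongrightarrow> 0"
proof -
  let ?U = "\<lambda>N. 1 / real N * (\<Sum>x=1..N. (u N x - h (real x / real N))\<^sup>2)"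
  let ?V = "\<lambda>N. 1 / real N * (\<Sum>x=1..N. (v N x - k (real x / real N))\<^sup>2)"
  have expand: "1 / real N * (\<Sum>x=1..N. (a x - b x)\<^sup>2) = 1 / real N * (\<Sum>x=1..N. (a x)\<^sup>2)
      - 2 * (1 / real N * (\<Sum>x=1..N. a x * b x)) + 1 / real N * (\<Sum>x=1..N. (b x)\<^sup>2)" for N and a b :: "nat \<Rightarrow> real"
  proof -
    have "(\<Sum>x=1..N. (a x - b x)\<^sup>2) = (\<Sum>x=1..N. (a x)\<^sup>2) - 2 * (\<Sum>x=1..N. a x * b x) + (\<Sum>x=1..N. (b x)\<^sup>2)"
      by (simp add: power2_diff sum.distrib sum_subtractf sum_distrib_left mult.assoc)
    then show ?thesis by (simp only: distrib_left right_diff_distrib mult.left_commute)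
  qed
  define A where "A N = 1 / real N * (\<Sum>x=1..N. (u N x)\<^sup>2)" for N
  define A' where "A' N = 1 / real N * (\<Sum>x=1..N. (v N x)\<^sup>2)" for N
  define B where "B N = 1 / real N * (\<Sum>x=1..N. u N x * h (real x / real N))" for N
  define B' where "B' N = 1 / real N * (\<Sum>x=1..N. v N x * k (real x / real N))" for N
  define C where "C N = 1 / real N * (\<Sum>x=1..N. (h (real x / real N))\<^sup>2)" for N
  define C' where "C' N = 1 / real N * (\<Sum>x=1..N. (k (real x / real N))\<^sup>2)" for N
  let ?H = "integral {0..1} (\<lambda>y. (h y)\<^sup>2)" and ?K = "integral {0..1} (\<lambda>y. (k y)\<^sup>2)"
  have lims: "B \<longlonglongrightarrow> ?H" "B' \<longlonglongrightarrow> ?K" "C \<longlonglongrightarrow> ?H" "C' \<longlonglongrightarrow> ?K"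
    unfolding B_def B'_def C_def C'_def
    using u[OF h] v[OF k] riemann_sums_converge[OF continuous_on_power[OF h, where n=2]] riemann_sums_converge[OF continuous_on_power[OF k, where n=2]]
    by (auto simp: power2_eq_square)
  have "(\<lambda>N. A N + A' N / m - 2 * B N + C N + (C' N - 2 * B' N) / m)
      \<longlonglongrightarrow> ?H + ?K / m - 2 * ?H + ?H + (?K - 2 * ?K) / m"
    by (intro tendsto_add[of _ _ _ "\<lambda>N. (C' N - 2 * B' N) / m"] tendsto_add[of _ _ _ C] tendsto_diff tendsto_divide
        tendsto_mult_left lims tendsto_const energy[folded A_def A'_def]) (use m in auto)
  moreover have "?H + ?K / m - 2 * ?H + ?H + (?K - 2 * ?K) / m = 0" by (simp add: diff_divide_distrib)
  moreover have "A N + A' N / m - 2 * B N + C N + (C' N - 2 * B' N) / m = ?U N + ?V N / m" for N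
    unfolding expand A_def[symmetric] A'_def[symmetric] B_def[symmetric] B'_def[symmetric] C_def[symmetric] C'_def[symmetric]
    by (simp add: add_divide_distrib diff_divide_distrib)
  ultimately have lim: "(\<lambda>N. ?U N + ?V N / m) \<longlonglongrightarrow> 0" by simp
  show "?U \<longlonglongrightarrow> 0"
  proof (rule tendsto_sandwich[OF _ _ tendsto_const lim])
    show "\<forall>\<^sub>F N in sequentially. ?U N \<le> ?U N + ?V N / m"
      using m average_of_squares_nonneg by (intro always_eventually allI) (simp only: le_add_same_cancel1 zero_le_divide_iff, blast intro: less_imp_le)
  qed (intro always_eventually allI average_of_squares_nonneg)
  show "?V \<longlonglongrightarrow> 0"
  \<comment> \<open>The second defect enters the sum divided by \<open>m\<close>, so the comparison
    is with \<open>m\<close> times the sum.\<close>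
  proof (rule tendsto_sandwich[OF _ _ tendsto_const tendsto_mult_right_zero[OF lim, of m]])
    show "\<forall>\<^sub>F N in sequentially. ?V N \<le> m * (?U N + ?V N / m)"
    proof (intro always_eventually allI)
      fix N
      have "0 \<le> m * ?U N" by (intro mult_nonneg_nonneg average_of_squares_nonneg less_imp_le[OF m])
      moreover have "m * (?U N + ?V N / m) = m * ?U N + ?V N" using m by (simp add: distrib_left)
      ultimately show "?V N \<le> m * (?U N + ?V N / m)" by linarith
    qed
  qed (intro always_eventually allI average_of_squares_nonneg)
qed

text \<open>In \<open>u^2 = (u - h)^2 + 2 u h - h^2\<close> the first term is negligible by strong
  convergence, the second is linear in \<open>u\<close> with the test function \<open>h f\<close>,
  and the third is a Riemann sum.\<close>

lemma average_of_weighted_squares_limit: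
  fixes u :: "nat \<Rightarrow> nat \<Rightarrow> real" and h f :: "real \<Rightarrow> real"
  assumes h: "continuous_on {0..1} h" and f: "continuous_on {0..1} f"
    and u: "\<And>f. continuous_on {0..1} f \<Longrightarrow>
      (\<lambda>N. 1 / real N * (\<Sum>x=1..N. u N x * f (real x / real N))) \<longlonglongrightarrow> integral {0..1} (\<lambda>y. h y * f y)"
    and strong: "(\<lambda>N. 1 / real N * (\<Sum>x=1..N. (u N x - h (real x / real N))\<^sup>2)) \<longlonglongrightarrow> 0"
  shows "(\<lambda>N. 1 / real N * (\<Sum>x=1..N. f (real x / real N) * (u N x)\<^sup>2)) \<longlonglongrightarrow> integral {0..1} (\<lambda>y. (h y)\<^sup>2 * f y)"
proof -
  let ?d = "\<lambda>N x. u N x - h (real x / real N)"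
  obtain C where "\<forall>z\<in>f ` {0..1}. norm z \<le> C"
    using compact_imp_bounded[OF compact_continuous_image[OF f compact_Icc]]
    unfolding bounded_iff by blast
  then have C: "\<bar>f y\<bar> \<le> C" if "y \<in> {0..1}" for y using that by auto
  have "(\<lambda>N. 1 / real N * (\<Sum>x=1..N. f (real x / real N) * (?d N x)\<^sup>2)) \<longlonglongrightarrow> 0"
  proof (rule Lim_null_comparison)
    show "\<forall>\<^sub>F N in sequentially. norm (1 / real N * (\<Sum>x=1..N. f (real x / real N) * (?d N x)\<^sup>2))
        \<le> C * (1 / real N * (\<Sum>x=1..N. (?d N x)\<^sup>2))"
    proof (intro always_eventually allI)
      fix N
      have "\<bar>\<Sum>x=1..N. f (real x / real N) * (?d N x)\<^sup>2\<bar> \<le> (\<Sum>x=1..N. \<bar>f (real x / real N) * (?d N x)\<^sup>2\<bar>)"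
        by (rule sum_abs)
      also have "\<dots> \<le> (\<Sum>x=1..N. C * (?d N x)\<^sup>2)"
        by (intro sum_mono) (auto simp: abs_mult intro!: mult_right_mono C)
      finally have "1 / real N * \<bar>\<Sum>x=1..N. f (real x / real N) * (?d N x)\<^sup>2\<bar> \<le> 1 / real N * (\<Sum>x=1..N. C * (?d N x)\<^sup>2)"
        by (intro mult_left_mono) auto
      then show "norm (1 / real N * (\<Sum>x=1..N. f (real x / real N) * (?d N x)\<^sup>2)) \<le> C * (1 / real N * (\<Sum>x=1..N. (?d N x)\<^sup>2))"
        by (simp add: abs_mult sum_distrib_left[symmetric])
    qed
    show "(\<lambda>N. C * (1 / real N * (\<Sum>x=1..N. (?d N x)\<^sup>2))) \<longlonglongrightarrow> 0"
      by (rule tendsto_mult_right_zero[OF strong])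
  qed
  moreover have "(\<lambda>N. 1 / real N * (\<Sum>x=1..N. u N x * (h (real x / real N) * f (real x / real N))))
      \<longlonglongrightarrow> integral {0..1} (\<lambda>y. h y * (h y * f y))"
    by (rule u) (intro continuous_intros h f)
  moreover have "(\<lambda>N. 1 / real N * (\<Sum>x=1..N. (h (real x / real N))\<^sup>2 * f (real x / real N)))
      \<longlonglongrightarrow> integral {0..1} (\<lambda>y. (h y)\<^sup>2 * f y)"
    by (rule riemann_sums_converge) (intro continuous_intros h f)
  ultimately have "(\<lambda>N. 1 / real N * (\<Sum>x=1..N. f (real x / real N) * (?d N x)\<^sup>2)
       + 2 * (1 / real N * (\<Sum>x=1..N. u N x * (h (real x / real N) * f (real x / real N))))
       - 1 / real N * (\<Sum>x=1..N. (h (real x / real N))\<^sup>2 * f (real x / real N)))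
     \<longlonglongrightarrow> 0 + 2 * integral {0..1} (\<lambda>y. h y * (h y * f y)) - integral {0..1} (\<lambda>y. (h y)\<^sup>2 * f y)"
    by (intro tendsto_intros)
  moreover have "1 / real N * (\<Sum>x=1..N. f (real x / real N) * (?d N x)\<^sup>2)
       + 2 * (1 / real N * (\<Sum>x=1..N. u N x * (h (real x / real N) * f (real x / real N))))
       - 1 / real N * (\<Sum>x=1..N. (h (real x / real N))\<^sup>2 * f (real x / real N))
     = 1 / real N * (\<Sum>x=1..N. f (real x / real N) * (u N x)\<^sup>2)" for N
  proof -
    have "f (real x / real N) * (?d N x)\<^sup>2 + 2 * (u N x * (h (real x / real N) * f (real x / real N)))
        - (h (real x / real N))\<^sup>2 * f (real x / real N) = f (real x / real N) * (u N x)\<^sup>2" for x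
      by (simp add: power2_eq_square algebra_simps)
    then have "(\<Sum>x=1..N. f (real x / real N) * (u N x)\<^sup>2) = (\<Sum>x=1..N. f (real x / real N) * (?d N x)\<^sup>2)
        + 2 * (\<Sum>x=1..N. u N x * (h (real x / real N) * f (real x / real N)))
        - (\<Sum>x=1..N. (h (real x / real N))\<^sup>2 * f (real x / real N))"
      by (simp only: sum.distrib[symmetric] sum_subtractf[symmetric] sum_distrib_left)
    then show ?thesis by (simp only: distrib_left right_diff_distrib mult.left_commute)
  qed
  moreover have "integral {0..1} (\<lambda>y. h y * (h y * f y)) = integral {0..1} (\<lambda>y. (h y)\<^sup>2 * f y)"
    by (simp add: power2_eq_square mult.assoc)
  ultimately show ?thesis by simp
qed

text \<open>Momentum modes of the chain sit at \<open>x - 1/2\<close>, the averages at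
  \<open>x\<close>. The phases differ by \<open>c / (2 N)\<close>, so the cosines differ by at most
  \<open>c / N\<close> in absolute value, which vanishes against a bounded profile.\<close>

lemma half_site_shift_negligible:
  fixes v :: "nat \<Rightarrow> nat \<Rightarrow> real" and c :: real
  assumes bound: "\<forall>\<^sub>F N in sequentially. 1 / real N * (\<Sum>x=1..N. (v N x)\<^sup>2) \<le> C"
  shows "(\<lambda>N. 1 / real N * (\<Sum>x=1..N. v N x * (cos (c * (real x / real N)) - cos (c / real N * (real x - 1/2))))) \<longlonglongrightarrow> 0"
proof (rule average_product_tendsto_zero[OF bound])
  let ?d = "\<lambda>N x. cos (c * (real x / real N)) - cos (c / real N * (real x - 1/2))"
  have d: "(?d N x)\<^sup>2 \<le> (c / real N)\<^sup>2" for N x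
  proof -
    \<comment> \<open>For \<open>N = 0\<close> division by zero gives 0 on both sides.\<close>
    have eq: "(c / real N * (real x - 1/2) - c * (real x / real N)) / 2 = - (c / real N) / 4"
      by (cases "N = 0") (auto simp: field_simps)
    have "\<bar>?d N x\<bar> = 2 * \<bar>sin ((c * (real x / real N) + c / real N * (real x - 1/2)) / 2)\<bar> * \<bar>sin (- (c / real N) / 4)\<bar>"
      unfolding cos_diff_cos eq by (simp add: abs_mult)
    also have "\<dots> \<le> 2 * 1 * \<bar>- (c / real N) / 4\<bar>"
      by (intro mult_mono abs_sin_x_le_abs_x) auto
    also have "\<bar>- (c / real N) / 4\<bar> = \<bar>c / real N\<bar> / 4"
      by (simp only: abs_divide abs_minus_cancel abs_numeral)
    also have "2 * 1 * (\<bar>c / real N\<bar> / 4) \<le> \<bar>c / real N\<bar>"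
      using abs_ge_zero[of "c / real N"] by (simp only: mult_1_right) (simp del: abs_divide)
    finally show ?thesis by (simp only: abs_le_square_iff)
  qed
  show "(\<lambda>N. 1 / real N * (\<Sum>x=1..N. (?d N x)\<^sup>2)) \<longlonglongrightarrow> 0"
  proof (rule tendsto_sandwich[OF _ _ tendsto_const])
    show "\<forall>\<^sub>F N in sequentially. 1 / real N * (\<Sum>x=1..N. (?d N x)\<^sup>2) \<le> (c / real N)\<^sup>2"
    proof (intro always_eventually allI)
      fix N
      have "1 / real N * (\<Sum>x=1..N. (?d N x)\<^sup>2) \<le> 1 / real N * (\<Sum>x=1..N. (c / real N)\<^sup>2)"
        by (intro mult_left_mono sum_mono d) auto
      also have "\<dots> \<le> (c / real N)\<^sup>2" by (cases "N = 0") auto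
      finally show "1 / real N * (\<Sum>x=1..N. (?d N x)\<^sup>2) \<le> (c / real N)\<^sup>2" .
    qed
    have "(\<lambda>N. c * (1 / real N)) \<longlonglongrightarrow> c * 0"
      by (intro tendsto_mult tendsto_const lim_1_over_n)
    from tendsto_power[OF this, of 2] show "(\<lambda>N. (c / real N)\<^sup>2) \<longlonglongrightarrow> 0" by simp
  qed (intro always_eventually allI average_of_squares_nonneg)
qed

section \<open>Normal modes of the chain\<close>

text \<open>\<open>sin (\<theta> x)\<close> vanishes at 0 and at \<open>N\<close>, as the stretch
  must. The stretch \<open>r_x\<close> lies between the masses \<open>x\<close> and
  \<open>x + 1\<close>, so the momentum modes are centred at \<open>x - 1/2\<close>; a discrete
  difference then turns one family into the other with the exact factor
  \<open>2 sin (\<theta>/2)\<close>, up to sign, which fixes the dispersion relation for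
  \<open>\<omega>\<close>. The two solutions start from pure stretch and from pure momentum. Their
  data need no restriction, as \<open>chain_solution\<close> reads only values at the sites.\<close>

lemma chain_solution_normal_modes:
  fixes k N :: nat
  assumes N: "N \<ge> 1" and m: "m > 0"
  defines "\<theta> \<equiv> real k * pi / real N" and "\<omega> \<equiv> 2 * sin (real k * pi / real N / 2) / sqrt m"
  shows "chain_solution N (\<lambda>_. m) (\<lambda>x. sin (\<theta> * real x), \<lambda>_. 0)
     (\<lambda>s x. cos (\<omega> * s) * sin (\<theta> * real x)) (\<lambda>s x. sqrt m * sin (\<omega> * s) * cos (\<theta> * (real x - 1/2)))"
    and "chain_solution N (\<lambda>_. m) (\<lambda>_. 0, \<lambda>x. cos (\<theta> * (real x - 1/2)))
     (\<lambda>s x. - sin (\<omega> * s) / sqrt m * sin (\<theta> * real x)) (\<lambda>s x. cos (\<omega> * s) * cos (\<theta> * (real x - 1/2)))"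
proof -
  have bd: "sin (\<theta> * real N) = 0" using N by (simp add: \<theta>_def)
  have sm: "sqrt m > 0" "sqrt m * sqrt m = m" using m by auto
  have \<omega>: "2 * sin (\<theta> / 2) = sqrt m * \<omega>" using sm by (simp add: \<omega>_def \<theta>_def)
  have c: "cos (\<theta> * (real (x + 1) - 1/2)) - cos (\<theta> * (real x - 1/2)) = - sqrt m * \<omega> * sin (\<theta> * real x)" for x
  proof -
    have a: "(\<theta> * (real (x + 1) - 1/2) + \<theta> * (real x - 1/2)) / 2 = \<theta> * real x"
      "(\<theta> * (real x - 1/2) - \<theta> * (real (x + 1) - 1/2)) / 2 = - (\<theta> / 2)" by (simp_all add: field_simps)
    have "cos (\<theta> * (real (x + 1) - 1/2)) - cos (\<theta> * (real x - 1/2)) = - (2 * sin (\<theta> / 2)) * sin (\<theta> * real x)"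
      unfolding cos_diff_cos a by simp
    then show ?thesis unfolding \<omega> by simp
  qed
  have s: "sin (\<theta> * real x) - sin (\<theta> * real (x - 1)) = sqrt m * \<omega> * cos (\<theta> * (real x - 1/2))" if "x \<ge> 1" for x
  proof -
    have a: "(\<theta> * real x + \<theta> * real (x - 1)) / 2 = \<theta> * (real x - 1/2)"
      "(\<theta> * real x - \<theta> * real (x - 1)) / 2 = \<theta> / 2" using that by (simp_all add: of_nat_diff field_simps)
    have "sin (\<theta> * real x) - sin (\<theta> * real (x - 1)) = (2 * sin (\<theta> / 2)) * cos (\<theta> * (real x - 1/2))"
      unfolding sin_diff_sin a by simp
    then show ?thesis unfolding \<omega> by simp
  qed
  show "chain_solution N (\<lambda>_. m) (\<lambda>x. sin (\<theta> * real x), \<lambda>_. 0)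
     (\<lambda>s x. cos (\<omega> * s) * sin (\<theta> * real x)) (\<lambda>s x. sqrt m * sin (\<omega> * s) * cos (\<theta> * (real x - 1/2)))"
    unfolding chain_solution_def
  proof (intro conjI ballI allI impI)
    fix u :: real and x assume "x \<in> {1..N-1}"
    have "sqrt m * sin (\<omega> * u) * cos (\<theta> * (real (x + 1) - 1/2)) / m - sqrt m * sin (\<omega> * u) * cos (\<theta> * (real x - 1/2)) / m
        = sqrt m * sin (\<omega> * u) * (- sqrt m * \<omega> * sin (\<theta> * real x)) / m"
      unfolding c[symmetric] by (simp add: right_diff_distrib diff_divide_distrib)
    also have "\<dots> = - sin (\<omega> * u) * \<omega> * sin (\<theta> * real x) * (sqrt m * sqrt m) / m" by simp
    also have "\<dots> = - sin (\<omega> * u) * \<omega> * sin (\<theta> * real x)" unfolding sm(2) using m by simp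
    finally show "((\<lambda>u. cos (\<omega> * u) * sin (\<theta> * real x)) has_real_derivative
       sqrt m * sin (\<omega> * u) * cos (\<theta> * (real (x + 1) - 1/2)) / m - sqrt m * sin (\<omega> * u) * cos (\<theta> * (real x - 1/2)) / m) (at u within {0..})"
      by (auto intro!: derivative_eq_intros)
  next
    fix u :: real and x assume x: "x \<in> {1..N}"
    have "cos (\<omega> * u) * sin (\<theta> * real x) - cos (\<omega> * u) * sin (\<theta> * real (x - 1)) = cos (\<omega> * u) * (sqrt m * \<omega> * cos (\<theta> * (real x - 1/2)))"
      using s[of x] x by (simp add: right_diff_distrib[symmetric])
    then show "((\<lambda>u. sqrt m * sin (\<omega> * u) * cos (\<theta> * (real x - 1/2))) has_real_derivative
       cos (\<omega> * u) * sin (\<theta> * real x) - cos (\<omega> * u) * sin (\<theta> * real (x - 1))) (at u within {0..})"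
      by (auto intro!: derivative_eq_intros)
  qed (use bd in auto)
  show "chain_solution N (\<lambda>_. m) (\<lambda>_. 0, \<lambda>x. cos (\<theta> * (real x - 1/2)))
     (\<lambda>s x. - sin (\<omega> * s) / sqrt m * sin (\<theta> * real x)) (\<lambda>s x. cos (\<omega> * s) * cos (\<theta> * (real x - 1/2)))"
    unfolding chain_solution_def
  proof (intro conjI ballI allI impI)
    fix u :: real and x assume "x \<in> {1..N-1}"
    have "cos (\<omega> * u) * cos (\<theta> * (real (x + 1) - 1/2)) / m - cos (\<omega> * u) * cos (\<theta> * (real x - 1/2)) / m
        = cos (\<omega> * u) * (- sqrt m * \<omega> * sin (\<theta> * real x)) / (sqrt m * sqrt m)"
      unfolding c[symmetric] sm(2) by (simp add: right_diff_distrib diff_divide_distrib)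
    also have "\<dots> = - cos (\<omega> * u) * \<omega> / sqrt m * sin (\<theta> * real x)" using sm(1) by (simp add: field_simps)
    finally have eq: "cos (\<omega> * u) * cos (\<theta> * (real (x + 1) - 1/2)) / m - cos (\<omega> * u) * cos (\<theta> * (real x - 1/2)) / m
        = - cos (\<omega> * u) * \<omega> / sqrt m * sin (\<theta> * real x)" .
    have "((\<lambda>u. - sin (\<omega> * u)) has_real_derivative - cos (\<omega> * u) * \<omega>) (at u within {0..})"
      by (auto intro!: derivative_eq_intros)
    from DERIV_cmult_right[OF DERIV_cdivide[OF this]]
    show "((\<lambda>u. - sin (\<omega> * u) / sqrt m * sin (\<theta> * real x)) has_real_derivative
       cos (\<omega> * u) * cos (\<theta> * (real (x + 1) - 1/2)) / m - cos (\<omega> * u) * cos (\<theta> * (real x - 1/2)) / m) (at u within {0..})"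
      unfolding eq .
  next
    fix u :: real and x assume x: "x \<in> {1..N}"
    have "- sin (\<omega> * u) / sqrt m * sin (\<theta> * real x) - - sin (\<omega> * u) / sqrt m * sin (\<theta> * real (x - 1))
        = - sin (\<omega> * u) / sqrt m * (sqrt m * \<omega> * cos (\<theta> * (real x - 1/2)))"
      using s[of x] x by (simp only: right_diff_distrib[symmetric] atLeastAtMost_iff)
    also have "\<dots> = - sin (\<omega> * u) * \<omega> * cos (\<theta> * (real x - 1/2))" using sm(1) by simp
    finally show "((\<lambda>u. cos (\<omega> * u) * cos (\<theta> * (real x - 1/2))) has_real_derivative
       - sin (\<omega> * u) / sqrt m * sin (\<theta> * real x) - - sin (\<omega> * u) / sqrt m * sin (\<theta> * real (x - 1))) (at u within {0..})"
      by (auto intro!: derivative_eq_intros)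
  qed (use bd in auto)
qed

text \<open>Reciprocity with a normal mode as second solution expresses a Fourier coefficient at
  time \<open>s\<close> by those at time 0, so the solution never has to be expanded in
  modes.\<close>

lemma chain_mode_evolution:
  fixes k N :: nat
  assumes N: "N \<ge> 1" and m: "m > 0" and s: "s \<ge> 0" and sol: "chain_solution N (\<lambda>_. m) w r p"
  defines "\<theta> \<equiv> real k * pi / real N" and "\<omega> \<equiv> 2 * sin (real k * pi / real N / 2) / sqrt m"
  shows "(\<Sum>x=1..N. r s x * sin (\<theta> * real x)) = cos (\<omega> * s) * (\<Sum>x=1..N. fst w x * sin (\<theta> * real x))
      - sin (\<omega> * s) * (\<Sum>x=1..N. snd w x * cos (\<theta> * (real x - 1/2))) / sqrt m"
    and "(\<Sum>x=1..N. p s x * cos (\<theta> * (real x - 1/2))) = cos (\<omega> * s) * (\<Sum>x=1..N. snd w x * cos (\<theta> * (real x - 1/2)))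
      + sqrt m * sin (\<omega> * s) * (\<Sum>x=1..N. fst w x * sin (\<theta> * real x))"
proof -
  have m0: "m \<noteq> 0" and sm: "sqrt m > 0" "m = sqrt m * sqrt m" using m by auto
  have bd: "sin (\<theta> * real N) = 0" using N by (simp add: \<theta>_def)
  \<comment> \<open>\<open>fst w N\<close> lies outside the range of the stretch variables and may
    be any value; the sine at \<open>N\<close> removes it.\<close>
  have last: "(\<Sum>x=1..N. a x * sin (\<theta> * real x)) = (\<Sum>x=1..N-1. a x * sin (\<theta> * real x))" for a :: "nat \<Rightarrow> real"
  proof -
    obtain n where "N = Suc n" using N by (cases N) auto
    then show ?thesis using bd by simp
  qed
  let ?S = "\<Sum>x=1..N-1. fst w x * sin (\<theta> * real x)" and ?C = "\<Sum>x=1..N. snd w x * cos (\<theta> * (real x - 1/2))"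
  note mode = chain_solution_normal_modes[OF N m, of k, folded \<theta>_def \<omega>_def]
  have "(\<Sum>x=1..N-1. r s x * sin (\<theta> * real x)) = (\<Sum>x=1..N-1. fst w x * (cos (\<omega> * s) * sin (\<theta> * real x)))
      - (\<Sum>x=1..N. snd w x * (sqrt m * sin (\<omega> * s) * cos (\<theta> * (real x - 1/2)))) / m"
    using chain_reciprocity[OF N m0 s sol mode(1)] by simp
  also have "(\<Sum>x=1..N-1. fst w x * (cos (\<omega> * s) * sin (\<theta> * real x))) = cos (\<omega> * s) * ?S"
    by (simp add: sum_distrib_left mult_ac)
  also have "(\<Sum>x=1..N. snd w x * (sqrt m * sin (\<omega> * s) * cos (\<theta> * (real x - 1/2)))) = sqrt m * sin (\<omega> * s) * ?C"
    by (simp add: sum_distrib_left mult_ac)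
  also have "sqrt m * sin (\<omega> * s) * ?C / m = sin (\<omega> * s) * ?C / sqrt m"
  proof -
    have "sqrt m / m = 1 / sqrt m" using m by (simp add: field_simps)
    moreover have "sqrt m * sin (\<omega> * s) * ?C / m = (sqrt m / m) * (sin (\<omega> * s) * ?C)" by simp
    ultimately show ?thesis by simp
  qed
  finally show "(\<Sum>x=1..N. r s x * sin (\<theta> * real x)) = cos (\<omega> * s) * (\<Sum>x=1..N. fst w x * sin (\<theta> * real x))
      - sin (\<omega> * s) * (\<Sum>x=1..N. snd w x * cos (\<theta> * (real x - 1/2))) / sqrt m"
    unfolding last .
  \<comment> \<open>The momentum mode pairs with the minus sign and the factor \<open>1 / m\<close>
    of the twisted form, which the final division undoes.\<close>
  have "- (\<Sum>x=1..N. p s x * cos (\<theta> * (real x - 1/2))) / m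
     = (\<Sum>x=1..N-1. fst w x * (- sin (\<omega> * s) / sqrt m * sin (\<theta> * real x)))
      - (\<Sum>x=1..N. snd w x * (cos (\<omega> * s) * cos (\<theta> * (real x - 1/2)))) / m"
    using chain_reciprocity[OF N m0 s sol mode(2)] by simp
  also have "(\<Sum>x=1..N-1. fst w x * (- sin (\<omega> * s) / sqrt m * sin (\<theta> * real x))) = - sin (\<omega> * s) / sqrt m * ?S"
    unfolding sum_distrib_left by (intro sum.cong refl) (simp only: mult_ac)
  also have "(\<Sum>x=1..N. snd w x * (cos (\<omega> * s) * cos (\<theta> * (real x - 1/2)))) = cos (\<omega> * s) * ?C"
    by (simp add: sum_distrib_left mult_ac)
  finally have "(\<Sum>x=1..N. p s x * cos (\<theta> * (real x - 1/2))) = cos (\<omega> * s) * ?C + m / sqrt m * sin (\<omega> * s) * ?S"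
    using m by (simp add: field_simps)
  also have "m / sqrt m = sqrt m" using m by (simp add: real_div_sqrt)
  finally show "(\<Sum>x=1..N. p s x * cos (\<theta> * (real x - 1/2))) = cos (\<omega> * s) * (\<Sum>x=1..N. snd w x * cos (\<theta> * (real x - 1/2)))
      + sqrt m * sin (\<omega> * s) * (\<Sum>x=1..N. fst w x * sin (\<theta> * real x))"
    unfolding last .
qed

subsection \<open>The hydrodynamic limit\<close>

text \<open>The expectation follows a single deterministic trajectory, the one from the mean point,
  so the limit can be taken without any probability; thermal variances are added afterwards.\<close>

lemma mean_chain_hydrodynamic_limit:
  fixes u v :: "nat \<Rightarrow> nat \<Rightarrow> real"
  assumes m: "m > 0" and t: "t \<in> {0..T}"
    and rini: "continuous_on {0..1} rini" and rini1: "rini 1 = 0" and pini: "continuous_on {0..1} pini"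
    and macro: "macro_solution m \<beta> T rini pini r p e"
    and sol: "\<And>N. N \<ge> 1 \<Longrightarrow> chain_solution N (\<lambda>_. m) (mean_point N rini pini) (R N) (P N)"
  defines "u \<equiv> \<lambda>N. R N (real N * t)" and "v \<equiv> \<lambda>N. P N (real N * t)"
  assumes f: "continuous_on {0..1} f"
  shows "(\<lambda>N. 1 / real N * (\<Sum>x=1..N. u N x * f (real x / real N))) \<longlonglongrightarrow> integral {0..1} (\<lambda>y. r y t * f y)"
    and "(\<lambda>N. 1 / real N * (\<Sum>x=1..N. v N x * f (real x / real N))) \<longlonglongrightarrow> integral {0..1} (\<lambda>y. p y t * f y)"
    and "(\<lambda>N. 1 / real N * (\<Sum>x=1..N. f (real x / real N) * (u N x)\<^sup>2)) \<longlonglongrightarrow> integral {0..1} (\<lambda>y. (r y t)\<^sup>2 * f y)"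
    and "(\<lambda>N. 1 / real N * (\<Sum>x=1..N. f (real x / real N) * (v N x)\<^sup>2)) \<longlonglongrightarrow> integral {0..1} (\<lambda>y. (p y t)\<^sup>2 * f y)"
proof -
  have r: "continuous_on {0..1} (\<lambda>y. r y t)" and p: "continuous_on {0..1} (\<lambda>y. p y t)"
    using macro t unfolding macro_solution_def by (auto intro: continuous_on_time_slice)
  let ?avg = "\<lambda>N (a :: nat \<Rightarrow> real). 1 / real N * (\<Sum>x=1..N. a x)"
  define rN where "rN N x = rini (real x / real N)" for N x :: nat
  define pN where "pN N x = pini (real x / real N)" for N x :: nat
  have w0: "fst (mean_point N rini pini) x = rN N x" if "x \<in> {1..N-1}" for N x
    using that by (simp add: mean_point_def rN_def)
  have w0': "snd (mean_point N rini pini) x = pN N x" if "x \<in> {1..N}" for N x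
    using that by (simp add: mean_point_def pN_def)
  \<comment> \<open>The conservation law sums stretches up to \<open>N - 1\<close>, the averages up
    to \<open>N\<close>. The extra term is 0 at time \<open>N t\<close> because
    \<open>r_N = 0\<close>, and at time 0 because \<open>rini 1 = 0\<close>.\<close>
  have drop_last: "(\<Sum>x=1..N. a x) = (\<Sum>x=1..N-1. a x)" if "N \<ge> 1" "a N = 0" for N and a :: "nat \<Rightarrow> real"
  proof -
    obtain n where "N = Suc n" using \<open>N \<ge> 1\<close> by (cases N) auto
    then show ?thesis using that by simp
  qed
  have tN: "real N * t \<ge> 0" for N using t by simp
  have uN: "u N N = 0" if "N \<ge> 1" for N
    using sol[OF that] tN[of N] unfolding chain_solution_def u_def by auto
  have rNN: "rN N N = 0" if "N \<ge> 1" for N using that rini1 by (simp add: rN_def)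

  \<comment> \<open>The Riemann sums of the initial data converge to \<open>E\<close>, and
    conservation carries this limit over to time \<open>N t\<close>.\<close>
  define E where "E = integral {0..1} (\<lambda>y. (rini y)\<^sup>2) + integral {0..1} (\<lambda>y. (pini y)\<^sup>2) / m"
  have "(\<lambda>N. ?avg N (\<lambda>x. (rN N x)\<^sup>2) + ?avg N (\<lambda>x. (pN N x)\<^sup>2) / m) \<longlonglongrightarrow> E"
    unfolding E_def rN_def pN_def
    by (intro tendsto_add tendsto_divide tendsto_const riemann_sums_converge[where g="\<lambda>y. (rini y)\<^sup>2"]
        riemann_sums_converge[where g="\<lambda>y. (pini y)\<^sup>2"] continuous_intros rini pini) (use m in auto)
  moreover have "\<forall>\<^sub>F N in sequentially. ?avg N (\<lambda>x. (rN N x)\<^sup>2) + ?avg N (\<lambda>x. (pN N x)\<^sup>2) / m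
      = ?avg N (\<lambda>x. (u N x)\<^sup>2) + ?avg N (\<lambda>x. (v N x)\<^sup>2) / m"
    using eventually_ge_at_top[of 1]
  proof eventually_elim
    case (elim N)
    have "(\<Sum>x=1..N-1. (u N x)\<^sup>2) + (\<Sum>x=1..N. (v N x)\<^sup>2) / m
        = (\<Sum>x=1..N-1. (rN N x)\<^sup>2) + (\<Sum>x=1..N. (pN N x)\<^sup>2) / m"
      using chain_energy_conservation[OF elim _ tN sol[OF elim]] m
      by (simp add: u_def v_def w0 w0')
    then have "(\<Sum>x=1..N. (u N x)\<^sup>2) + (\<Sum>x=1..N. (v N x)\<^sup>2) / m = (\<Sum>x=1..N. (rN N x)\<^sup>2) + (\<Sum>x=1..N. (pN N x)\<^sup>2) / m"
      using drop_last[OF elim, of "\<lambda>x. (u N x)\<^sup>2"] drop_last[OF elim, of "\<lambda>x. (rN N x)\<^sup>2"] uN[OF elim] rNN[OF elim] by simp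
    then show ?case by (metis distrib_left times_divide_eq_right)
  qed
  ultimately have energy: "(\<lambda>N. ?avg N (\<lambda>x. (u N x)\<^sup>2) + ?avg N (\<lambda>x. (v N x)\<^sup>2) / m) \<longlonglongrightarrow> E"
    by (rule Lim_transform_eventually)
  \<comment> \<open>The conserved total bounds both nonnegative parts separately, eventually with
    slack 1.\<close>
  then have "\<forall>\<^sub>F N in sequentially. ?avg N (\<lambda>x. (u N x)\<^sup>2) + ?avg N (\<lambda>x. (v N x)\<^sup>2) / m < E + 1"
    by (rule order_tendstoD(2)) simp
  then have "\<forall>\<^sub>F N in sequentially. ?avg N (\<lambda>x. (u N x)\<^sup>2) \<le> E + 1 \<and> ?avg N (\<lambda>x. (v N x)\<^sup>2) \<le> m * (E + 1)"
  proof eventually_elim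
    case (elim N)
    have "?avg N (\<lambda>x. (v N x)\<^sup>2) / m \<ge> 0" using m by (intro divide_nonneg_pos average_of_squares_nonneg)
    moreover have "?avg N (\<lambda>x. (u N x)\<^sup>2) \<ge> 0" by (rule average_of_squares_nonneg)
    ultimately have "?avg N (\<lambda>x. (u N x)\<^sup>2) \<le> E + 1" "?avg N (\<lambda>x. (v N x)\<^sup>2) / m \<le> E + 1" using elim by linarith+
    then show ?case using m by (simp only: pos_divide_le_eq mult.commute simp_thms)
  qed
  then have ubd: "\<forall>\<^sub>F N in sequentially. ?avg N (\<lambda>x. (u N x)\<^sup>2) \<le> E + 1"
    and vbd: "\<forall>\<^sub>F N in sequentially. ?avg N (\<lambda>x. (v N x)\<^sup>2) \<le> m * (E + 1)"
    by (auto elim: eventually_mono)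
  \<comment> \<open>A bound on the initial momenta, needed for the half-site shift at time
    0.\<close>
  have "(\<lambda>N. ?avg N (\<lambda>x. (pN N x)\<^sup>2)) \<longlonglongrightarrow> integral {0..1} (\<lambda>y. (pini y)\<^sup>2)"
    unfolding pN_def by (rule riemann_sums_converge) (intro continuous_intros pini)
  then have "\<forall>\<^sub>F N in sequentially. ?avg N (\<lambda>x. (pN N x)\<^sup>2) < integral {0..1} (\<lambda>y. (pini y)\<^sup>2) + 1"
    by (rule order_tendstoD(2)) simp
  then have pbd: "\<forall>\<^sub>F N in sequentially. ?avg N (\<lambda>x. (pN N x)\<^sup>2) \<le> integral {0..1} (\<lambda>y. (pini y)\<^sup>2) + 1"
    by (rule eventually_mono) simp

  have modes: "(\<lambda>N. ?avg N (\<lambda>x. u N x * sin (real k * pi * (real x / real N)))) \<longlonglongrightarrow> integral {0..1} (\<lambda>y. r y t * sin (real k * pi * y))"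
    "(\<lambda>N. ?avg N (\<lambda>x. v N x * cos (real k * pi * (real x / real N)))) \<longlonglongrightarrow> integral {0..1} (\<lambda>y. p y t * cos (real k * pi * y))" for k
  proof -
    let ?c = "real k * pi"
    \<comment> \<open>The phase of mode \<open>k\<close> at time \<open>N t\<close>: the lattice
      frequency is of order \<open>1/N\<close>, so exactly this time scale has the nontrivial limit
      \<open>k pi t / sqrt m\<close>.\<close>
    define \<Omega> where "\<Omega> N = 2 * sin (?c / real N / 2) / sqrt m * (real N * t)" for N
    have "(\<lambda>N. 2 * (real N * sin (?c / 2 / real N)) / sqrt m * t) \<longlonglongrightarrow> 2 * (?c / 2) / sqrt m * t"
      by (intro tendsto_intros discrete_frequency_limit) (use m in auto)
    moreover have "2 * (real N * sin (?c / 2 / real N)) / sqrt m * t = \<Omega> N" for N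
      unfolding \<Omega>_def by (simp add: mult_ac)
    ultimately have \<Omega>: "\<Omega> \<longlonglongrightarrow> ?c / sqrt m * t" by simp
    define s where "s N x = sin (?c * (real x / real N))" for N x :: nat
    define c where "c N x = cos (?c * (real x / real N))" for N x :: nat
    define c' where "c' N x = cos (?c / real N * (real x - 1/2))" for N x :: nat
    have S: "(\<lambda>N. ?avg N (\<lambda>x. rN N x * s N x)) \<longlonglongrightarrow> integral {0..1} (\<lambda>y. rini y * sin (?c * y))"
      unfolding rN_def s_def by (rule riemann_sums_converge) (intro continuous_intros rini)
    \<comment> \<open>Used in both directions: the initial momenta pass from the grid, where Riemann
      sums converge, to the half-sites, where the mode evolution is exact; the momenta at time
      \<open>N t\<close> pass back.\<close>
    have shift: "(\<lambda>N. ?avg N (\<lambda>x. a N x * c N x)) \<longlonglongrightarrow> L \<longleftrightarrow> (\<lambda>N. ?avg N (\<lambda>x. a N x * c' N x)) \<longlonglongrightarrow> L"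
      if "\<forall>\<^sub>F N in sequentially. ?avg N (\<lambda>x. (a N x)\<^sup>2) \<le> B" for a B L
    proof (rule Lim_transform_eq)
      have "?avg N (\<lambda>x. a N x * c N x) - ?avg N (\<lambda>x. a N x * c' N x) = ?avg N (\<lambda>x. a N x * (c N x - c' N x))" for N
        by (simp only: right_diff_distrib sum_subtractf)
      then show "(\<lambda>N. ?avg N (\<lambda>x. a N x * c N x) - ?avg N (\<lambda>x. a N x * c' N x)) \<longlonglongrightarrow> 0"
        using half_site_shift_negligible[OF that, of ?c] unfolding c_def c'_def by simp
    qed
    have "(\<lambda>N. ?avg N (\<lambda>x. pN N x * c N x)) \<longlonglongrightarrow> integral {0..1} (\<lambda>y. pini y * cos (?c * y))"
      unfolding pN_def c_def by (rule riemann_sums_converge) (intro continuous_intros pini)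
    then have C: "(\<lambda>N. ?avg N (\<lambda>x. pN N x * c' N x)) \<longlonglongrightarrow> integral {0..1} (\<lambda>y. pini y * cos (?c * y))"
      unfolding shift[OF pbd] .
    have evol: "?avg N (\<lambda>x. u N x * s N x) = cos (\<Omega> N) * ?avg N (\<lambda>x. rN N x * s N x) - sin (\<Omega> N) * ?avg N (\<lambda>x. pN N x * c' N x) / sqrt m"
      "?avg N (\<lambda>x. v N x * c' N x) = cos (\<Omega> N) * ?avg N (\<lambda>x. pN N x * c' N x) + sqrt m * sin (\<Omega> N) * ?avg N (\<lambda>x. rN N x * s N x)"
      if N: "N \<ge> 1" for N
    proof -
      have s_eq: "sin (?c / real N * real x) = s N x" for x by (simp add: s_def)
      have sNN: "s N N = 0" using N by (simp add: s_def)
      have pt: "(\<Sum>x=1..N. fst (mean_point N rini pini) x * s N x) = (\<Sum>x=1..N. rN N x * s N x)"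
        using drop_last[OF N, of "\<lambda>x. fst (mean_point N rini pini) x * s N x"]
          drop_last[OF N, of "\<lambda>x. rN N x * s N x"] sNN
        by (simp add: w0[unfolded One_nat_def])
      have pt': "(\<Sum>x=1..N. snd (mean_point N rini pini) x * c' N x) = (\<Sum>x=1..N. pN N x * c' N x)"
        by (intro sum.cong refl) (simp only: w0')
      note ev = chain_mode_evolution[OF N m tN[of N] sol[OF N], of k, folded \<Omega>_def c'_def, unfolded s_eq pt pt', folded u_def v_def]
      show "?avg N (\<lambda>x. u N x * s N x) = cos (\<Omega> N) * ?avg N (\<lambda>x. rN N x * s N x) - sin (\<Omega> N) * ?avg N (\<lambda>x. pN N x * c' N x) / sqrt m"
        using ev(1) by (simp add: u_def diff_divide_distrib mult_ac)
      show "?avg N (\<lambda>x. v N x * c' N x) = cos (\<Omega> N) * ?avg N (\<lambda>x. pN N x * c' N x) + sqrt m * sin (\<Omega> N) * ?avg N (\<lambda>x. rN N x * s N x)"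
        using ev(2) by (simp add: v_def add_divide_distrib mult_ac)
    qed
    have "(\<lambda>N. cos (\<Omega> N) * ?avg N (\<lambda>x. rN N x * s N x) - sin (\<Omega> N) * ?avg N (\<lambda>x. pN N x * c' N x) / sqrt m)
      \<longlonglongrightarrow> integral {0..1} (\<lambda>y. r y t * sin (?c * y))"
      unfolding macro_solution_modes[OF macro m t]
      by (intro tendsto_diff tendsto_mult tendsto_divide tendsto_const tendsto_cos tendsto_sin \<Omega> S C) (use m in auto)
    then have "(\<lambda>N. ?avg N (\<lambda>x. u N x * s N x)) \<longlonglongrightarrow> integral {0..1} (\<lambda>y. r y t * sin (?c * y))"
      by (rule Lim_transform_eventually) (rule eventually_mono[OF eventually_ge_at_top[of 1] evol(1)[symmetric]])
    then show "(\<lambda>N. ?avg N (\<lambda>x. u N x * sin (real k * pi * (real x / real N)))) \<longlonglongrightarrow> integral {0..1} (\<lambda>y. r y t * sin (?c * y))"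
      unfolding s_def .
    have "(\<lambda>N. cos (\<Omega> N) * ?avg N (\<lambda>x. pN N x * c' N x) + sqrt m * sin (\<Omega> N) * ?avg N (\<lambda>x. rN N x * s N x))
      \<longlonglongrightarrow> integral {0..1} (\<lambda>y. p y t * cos (?c * y))"
      unfolding macro_solution_modes[OF macro m t]
      by (intro tendsto_add tendsto_mult tendsto_const tendsto_cos tendsto_sin \<Omega> S C)
    then have "(\<lambda>N. ?avg N (\<lambda>x. v N x * c' N x)) \<longlonglongrightarrow> integral {0..1} (\<lambda>y. p y t * cos (?c * y))"
      by (rule Lim_transform_eventually) (rule eventually_mono[OF eventually_ge_at_top[of 1] evol(2)[symmetric]])
    then show "(\<lambda>N. ?avg N (\<lambda>x. v N x * cos (real k * pi * (real x / real N)))) \<longlonglongrightarrow> integral {0..1} (\<lambda>y. p y t * cos (?c * y))"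
      unfolding shift[OF vbd, symmetric] unfolding c_def .
  qed

  have weak_u: "(\<lambda>N. ?avg N (\<lambda>x. u N x * g (real x / real N))) \<longlonglongrightarrow> integral {0..1} (\<lambda>y. r y t * g y)"
    if "continuous_on {0..1} g" for g
    by (rule weak_convergence_of_dense[OF ubd _ r that modes(1) sines_dense[OF that]]) (intro continuous_intros)
  have weak_v: "(\<lambda>N. ?avg N (\<lambda>x. v N x * g (real x / real N))) \<longlonglongrightarrow> integral {0..1} (\<lambda>y. p y t * g y)"
    if "continuous_on {0..1} g" for g
    by (rule weak_convergence_of_dense[OF vbd _ p that modes(2) cosines_dense[OF that]]) (intro continuous_intros)
  \<comment> \<open>Macroscopic conservation rewrites the limit \<open>E\<close>, made of initial
    data, as the norms of the solution at time \<open>t\<close>; this is the convergence of norms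
    required for strong convergence.\<close>
  note strong = strong_convergence_of_weak[OF m r p weak_u weak_v
      energy[unfolded E_def macro_energy_conservation[OF macro m t rini pini, symmetric]]]
  show "(\<lambda>N. ?avg N (\<lambda>x. u N x * f (real x / real N))) \<longlonglongrightarrow> integral {0..1} (\<lambda>y. r y t * f y)"
    by (rule weak_u[OF f])
  show "(\<lambda>N. ?avg N (\<lambda>x. v N x * f (real x / real N))) \<longlonglongrightarrow> integral {0..1} (\<lambda>y. p y t * f y)"
    by (rule weak_v[OF f])
  show "(\<lambda>N. ?avg N (\<lambda>x. f (real x / real N) * (u N x)\<^sup>2)) \<longlonglongrightarrow> integral {0..1} (\<lambda>y. (r y t)\<^sup>2 * f y)"
    by (rule average_of_weighted_squares_limit[OF r f weak_u strong(1)])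
  show "(\<lambda>N. ?avg N (\<lambda>x. f (real x / real N) * (v N x)\<^sup>2)) \<longlonglongrightarrow> integral {0..1} (\<lambda>y. (p y t)\<^sup>2 * f y)"
    by (rule average_of_weighted_squares_limit[OF p f weak_v strong(2)])
qed

text \<open>Each quadratic mean is the square of the mean plus a constant variance, so the two
  halves of the site energy add \<open>1/(2 \<beta>)\<close> each. At \<open>x = N\<close> the
  stretch is identically 0 and its half is missing.\<close>

lemma expected_profiles:
  fixes rini pini :: "real \<Rightarrow> real" and m \<beta> s :: real and N x :: nat
    and R P :: "phase_point \<Rightarrow> real \<Rightarrow> nat \<Rightarrow> real"
  assumes m: "m > 0" and \<beta>: "\<beta> > 0" and N: "N \<ge> 1" and s: "s \<ge> 0"
    and sol: "\<forall>w\<in>space (phase_lborel N). chain_solution N (\<lambda>_. m) w (R w) (P w)"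
  defines "M \<equiv> local_gibbs N (\<lambda>_. m) m \<beta> rini pini" and "w0 \<equiv> mean_point N rini pini"
  shows "x \<in> {1..N} \<Longrightarrow> (\<integral>w. R w s x \<partial>M) = R w0 s x"
    and "x \<in> {1..N} \<Longrightarrow> (\<integral>w. P w s x \<partial>M) = P w0 s x"
    and "x \<in> {1..N} \<Longrightarrow> (\<integral>w. site_energy (\<lambda>_. m) (R w s) (P w s) x \<partial>M)
      = (P w0 s x)\<^sup>2 / (2 * m) + (R w0 s x)\<^sup>2 / 2 + 1 / \<beta> - (if x = N then 1 / (2 * \<beta>) else 0)"
proof -
  note mom = chain_gibbs_moments[OF m \<beta> N s sol, where rini=rini and pini=pini, folded M_def w0_def]
  assume x: "x \<in> {1..N}"
  have RN: "R w s N = 0" if "w \<in> space (phase_lborel N)" for w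
    using sol that s unfolding chain_solution_def by auto
  have w0: "w0 \<in> space (phase_lborel N)" unfolding w0_def by (rule mean_point_in_space)
  have sp: "space M = space (phase_lborel N)" by (simp add: M_def local_gibbs_def)
  let ?V = "if x = N then 0 else 1 / \<beta>"
  have R: "has_bochner_integral M (\<lambda>w. R w s x) (R w0 s x) \<and>
      has_bochner_integral M (\<lambda>w. (R w s x)\<^sup>2) ((R w0 s x)\<^sup>2 + ?V)"
  proof (cases "x = N")
    case True
    have "has_bochner_integral M (\<lambda>w. R w s N) 0"
      \<comment> \<open>The stretch at \<open>N\<close> is known to vanish only for starting points
        in the phase space, which is all that the integral sees.\<close>
      by (subst has_bochner_integral_cong[OF refl _ refl, of _ _ "\<lambda>_. 0"]) (auto simp: sp RN has_bochner_integral_zero)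
    moreover have "has_bochner_integral M (\<lambda>w. (R w s N)\<^sup>2) 0"
      by (subst has_bochner_integral_cong[OF refl _ refl, of _ _ "\<lambda>_. 0"]) (auto simp: sp RN has_bochner_integral_zero)
    ultimately show ?thesis using RN[OF w0] True by simp
  next
    case False
    then have "x \<in> {1..N-1}" using x by auto
    with mom(1,2) False show ?thesis by simp
  qed
  then show "(\<integral>w. R w s x \<partial>M) = R w0 s x" by (simp add: has_bochner_integral_integral_eq)
  show "(\<integral>w. P w s x \<partial>M) = P w0 s x" using mom(3)[OF x] by (rule has_bochner_integral_integral_eq)
  have energy: "has_bochner_integral M (\<lambda>w. (P w s x)\<^sup>2 / (2 * m) + (R w s x)\<^sup>2 / 2)
     (((P w0 s x)\<^sup>2 + m / \<beta>) / (2 * m) + ((R w0 s x)\<^sup>2 + ?V) / 2)"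
    by (intro has_bochner_integral_add has_bochner_integral_divide mom(4)[OF x] R[THEN conjunct2])
  have eq: "((P w0 s x)\<^sup>2 + m / \<beta>) / (2 * m) + ((R w0 s x)\<^sup>2 + ?V) / 2
      = (P w0 s x)\<^sup>2 / (2 * m) + (R w0 s x)\<^sup>2 / 2 + 1 / \<beta> - (if x = N then 1 / (2 * \<beta>) else 0)"
    using m \<beta> by (auto simp: field_simps)
  show "(\<integral>w. site_energy (\<lambda>_. m) (R w s) (P w s) x \<partial>M)
      = (P w0 s x)\<^sup>2 / (2 * m) + (R w0 s x)\<^sup>2 / 2 + 1 / \<beta> - (if x = N then 1 / (2 * \<beta>) else 0)"
    unfolding site_energy_def has_bochner_integral_integral_eq[OF energy] by (rule eq)
qed

theorem mainTheorem3:
  fixes mbar T t \<beta> :: real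
    and f rini pini :: "real \<Rightarrow> real"
    and r p e :: "real \<Rightarrow> real \<Rightarrow> real"
    and R P :: "nat \<Rightarrow> phase_point \<Rightarrow> real \<Rightarrow> nat \<Rightarrow> real"
  assumes "mbar > 0" and "T > 0" and "t \<in> {0..T}" and "\<beta> > 0"
    and "continuous_on {0..1} f"
    and "Ck_unit 1 rini" and "rini 0 = 0" and "rini 1 = 0"
    and "Ck_unit 1 pini"
    and "macro_solution mbar \<beta> T rini pini r p e"
    and "\<And>N w. N \<ge> 1 \<Longrightarrow> w \<in> space (phase_lborel N) \<Longrightarrow>
           chain_solution N (\<lambda>_. mbar) w (R N w) (P N w)"
  shows "(\<lambda>N. 1 / real N * (\<Sum>x=1..N. f (real x / real N) *
            (\<integral>w. R N w (real N * t) x \<partial>local_gibbs N (\<lambda>_. mbar) mbar \<beta> rini pini)))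
          \<longlonglongrightarrow> integral {0..1} (\<lambda>y. r y t * f y) \<and>
         (\<lambda>N. 1 / real N * (\<Sum>x=1..N. f (real x / real N) *
            (\<integral>w. P N w (real N * t) x \<partial>local_gibbs N (\<lambda>_. mbar) mbar \<beta> rini pini)))
          \<longlonglongrightarrow> integral {0..1} (\<lambda>y. p y t * f y) \<and>
         (\<lambda>N. 1 / real N * (\<Sum>x=1..N. f (real x / real N) *
            (\<integral>w. site_energy (\<lambda>_. mbar) (R N w (real N * t)) (P N w (real N * t)) x
               \<partial>local_gibbs N (\<lambda>_. mbar) mbar \<beta> rini pini)))
          \<longlonglongrightarrow> integral {0..1} (\<lambda>y. e y t * f y)"
proof -
  note m = assms(1) and t = assms(3) and \<beta> = assms(4) and f = assms(5) and macro = assms(10) and sol = assms(11)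
  have rini: "continuous_on {0..1} rini" and pini: "continuous_on {0..1} pini"
    using assms(6,9) unfolding Ck_unit_def by (metis le0)+
  define u where "u N = R N (mean_point N rini pini) (real N * t)" for N
  define v where "v N = P N (mean_point N rini pini) (real N * t)" for N
  have mean_sol: "chain_solution N (\<lambda>_. mbar) (mean_point N rini pini)
      (R N (mean_point N rini pini)) (P N (mean_point N rini pini))" if "N \<ge> 1" for N
    using that by (intro sol mean_point_in_space)
  note lim = mean_chain_hydrodynamic_limit[OF m t rini assms(8) pini macro mean_sol f,
      folded u_def v_def]
  have tN: "real N * t \<ge> 0" for N using t by simp
  have sol': "\<forall>w\<in>space (phase_lborel N). chain_solution N (\<lambda>_. mbar) w (R N w) (P N w)" if "N \<ge> 1" for N
    using sol[OF that] by blast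
  let ?M = "\<lambda>N. local_gibbs N (\<lambda>_. mbar) mbar \<beta> rini pini"
  have ER: "(\<integral>w. R N w (real N * t) x \<partial>?M N) = u N x" and EP: "(\<integral>w. P N w (real N * t) x \<partial>?M N) = v N x"
    and Ee: "(\<integral>w. site_energy (\<lambda>_. mbar) (R N w (real N * t)) (P N w (real N * t)) x \<partial>?M N)
      = (v N x)\<^sup>2 / (2 * mbar) + (u N x)\<^sup>2 / 2 + 1 / \<beta> - (if x = N then 1 / (2 * \<beta>) else 0)"
    if "x \<in> {1..N}" for N x
  proof -
    have N: "N \<ge> 1" using that by simp
    note expect = expected_profiles[OF m \<beta> N tN[of N] sol'[OF N], where rini=rini and pini=pini, OF that]
    show "(\<integral>w. R N w (real N * t) x \<partial>?M N) = u N x" "(\<integral>w. P N w (real N * t) x \<partial>?M N) = v N x"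
      "(\<integral>w. site_energy (\<lambda>_. mbar) (R N w (real N * t)) (P N w (real N * t)) x \<partial>?M N)
        = (v N x)\<^sup>2 / (2 * mbar) + (u N x)\<^sup>2 / 2 + 1 / \<beta> - (if x = N then 1 / (2 * \<beta>) else 0)"
      unfolding u_def v_def by (fact expect)+
  qed
  have r: "continuous_on {0..1} (\<lambda>y. r y t)" and p: "continuous_on {0..1} (\<lambda>y. p y t)"
    using macro t unfolding macro_solution_def by (auto intro: continuous_on_time_slice)
  have "(\<lambda>N. 1 / real N * (\<Sum>x=1..N. f (real x / real N) *
            (\<integral>w. R N w (real N * t) x \<partial>local_gibbs N (\<lambda>_. mbar) mbar \<beta> rini pini)))
      = (\<lambda>N. 1 / real N * (\<Sum>x=1..N. f (real x / real N) * u N x))"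
    by (intro ext arg_cong2[where f="(*)"] sum.cong refl) (simp add: ER)
  moreover have "(\<lambda>N. 1 / real N * (\<Sum>x=1..N. f (real x / real N) *
            (\<integral>w. P N w (real N * t) x \<partial>local_gibbs N (\<lambda>_. mbar) mbar \<beta> rini pini)))
      = (\<lambda>N. 1 / real N * (\<Sum>x=1..N. f (real x / real N) * v N x))"
    by (intro ext arg_cong2[where f="(*)"] sum.cong refl) (simp add: EP)
  moreover have "(\<lambda>N. 1 / real N * (\<Sum>x=1..N. f (real x / real N) *
            (\<integral>w. site_energy (\<lambda>_. mbar) (R N w (real N * t)) (P N w (real N * t)) x
               \<partial>local_gibbs N (\<lambda>_. mbar) mbar \<beta> rini pini)))
          \<longlonglongrightarrow> integral {0..1} (\<lambda>y. e y t * f y)"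
  proof -
    \<comment> \<open>The last term is the missing thermal stretch energy of site \<open>N\<close>:
      a single site contributes \<open>f 1 / (2 \<beta>)\<close>, divided by
      \<open>N\<close>.\<close>
    have energy_lim: "(\<lambda>N. 1 / real N * (\<Sum>x=1..N. f (real x / real N) * (v N x)\<^sup>2) / (2 * mbar)
        + 1 / real N * (\<Sum>x=1..N. f (real x / real N) * (u N x)\<^sup>2) / 2
        + 1 / real N * (\<Sum>x=1..N. f (real x / real N)) / \<beta> - f 1 / (2 * \<beta>) * (1 / real N))
      \<longlonglongrightarrow> integral {0..1} (\<lambda>y. (p y t)\<^sup>2 * f y) / (2 * mbar) + integral {0..1} (\<lambda>y. (r y t)\<^sup>2 * f y) / 2
        + integral {0..1} f / \<beta> - f 1 / (2 * \<beta>) * 0"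
      using m \<beta> by (intro tendsto_add tendsto_diff tendsto_divide tendsto_mult tendsto_const lim_1_over_n
          lim(3,4) riemann_sums_converge f) auto
    have "((\<lambda>y. (p y t)\<^sup>2 * f y / (2 * mbar) + (r y t)\<^sup>2 * f y / 2 + f y / \<beta>) has_integral
       integral {0..1} (\<lambda>y. (p y t)\<^sup>2 * f y) / (2 * mbar) + integral {0..1} (\<lambda>y. (r y t)\<^sup>2 * f y) / 2
        + integral {0..1} f / \<beta>) {0..1}"
      by (intro has_integral_add has_integral_divide integrable_integral integrable_continuous_real continuous_intros r p f)
    then have "((\<lambda>y. e y t * f y) has_integral
       integral {0..1} (\<lambda>y. (p y t)\<^sup>2 * f y) / (2 * mbar) + integral {0..1} (\<lambda>y. (r y t)\<^sup>2 * f y) / 2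
        + integral {0..1} f / \<beta>) {0..1}"
      by (rule has_integral_eq[rotated]) (use macro t in \<open>auto simp: macro_solution_def distrib_right\<close>)
    then have energy_int: "integral {0..1} (\<lambda>y. (p y t)\<^sup>2 * f y) / (2 * mbar) + integral {0..1} (\<lambda>y. (r y t)\<^sup>2 * f y) / 2
        + integral {0..1} f / \<beta> = integral {0..1} (\<lambda>y. e y t * f y)"
      by (rule integral_unique[symmetric])
    have "\<forall>\<^sub>F N in sequentially. 1 / real N * (\<Sum>x=1..N. f (real x / real N) * (v N x)\<^sup>2) / (2 * mbar)
        + 1 / real N * (\<Sum>x=1..N. f (real x / real N) * (u N x)\<^sup>2) / 2
        + 1 / real N * (\<Sum>x=1..N. f (real x / real N)) / \<beta> - f 1 / (2 * \<beta>) * (1 / real N)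
      = 1 / real N * (\<Sum>x=1..N. f (real x / real N) *
            (\<integral>w. site_energy (\<lambda>_. mbar) (R N w (real N * t)) (P N w (real N * t)) x
               \<partial>local_gibbs N (\<lambda>_. mbar) mbar \<beta> rini pini))"
      using eventually_ge_at_top[of 1]
    proof eventually_elim
      case (elim N)
      have "(\<Sum>x=1..N. f (real x / real N) *
            (\<integral>w. site_energy (\<lambda>_. mbar) (R N w (real N * t)) (P N w (real N * t)) x
               \<partial>local_gibbs N (\<lambda>_. mbar) mbar \<beta> rini pini))
        = (\<Sum>x=1..N. f (real x / real N) * (v N x)\<^sup>2 / (2 * mbar) + f (real x / real N) * (u N x)\<^sup>2 / 2
            + f (real x / real N) / \<beta> - (if x = N then f 1 / (2 * \<beta>) else 0))"
      proof (rule sum.cong[OF refl])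
        fix x assume x: "x \<in> {1..N}"
        show "f (real x / real N) *
            (\<integral>w. site_energy (\<lambda>_. mbar) (R N w (real N * t)) (P N w (real N * t)) x
               \<partial>local_gibbs N (\<lambda>_. mbar) mbar \<beta> rini pini)
          = f (real x / real N) * (v N x)\<^sup>2 / (2 * mbar) + f (real x / real N) * (u N x)\<^sup>2 / 2
            + f (real x / real N) / \<beta> - (if x = N then f 1 / (2 * \<beta>) else 0)"
          \<comment> \<open>\<open>N \<ge> 1\<close> makes the sample point of site \<open>N\<close>
            equal to 1, so the correction carries the weight \<open>f 1\<close>.\<close>
          unfolding Ee[OF x] using elim by (cases "x = N") (simp_all add: distrib_left right_diff_distrib)
      qed
      also have "\<dots> = (\<Sum>x=1..N. f (real x / real N) * (v N x)\<^sup>2) / (2 * mbar) + (\<Sum>x=1..N. f (real x / real N) * (u N x)\<^sup>2) / 2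
            + (\<Sum>x=1..N. f (real x / real N)) / \<beta> - f 1 / (2 * \<beta>)"
        using elim by (simp add: sum.distrib sum_subtractf sum_divide_distrib)
      finally have eq: "(\<Sum>x=1..N. f (real x / real N) *
            (\<integral>w. site_energy (\<lambda>_. mbar) (R N w (real N * t)) (P N w (real N * t)) x
               \<partial>local_gibbs N (\<lambda>_. mbar) mbar \<beta> rini pini))
        = (\<Sum>x=1..N. f (real x / real N) * (v N x)\<^sup>2) / (2 * mbar) + (\<Sum>x=1..N. f (real x / real N) * (u N x)\<^sup>2) / 2
            + (\<Sum>x=1..N. f (real x / real N)) / \<beta> - f 1 / (2 * \<beta>)" .
      show ?case unfolding eq by (simp add: distrib_left right_diff_distrib)
    qed
    then show ?thesis
      by (rule Lim_transform_eventually[OF energy_lim[unfolded energy_int mult_zero_right diff_0_right]])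
  qed
  moreover have "(\<lambda>N. 1 / real N * (\<Sum>x=1..N. f (real x / real N) * u N x)) \<longlonglongrightarrow> integral {0..1} (\<lambda>y. r y t * f y)"
    "(\<lambda>N. 1 / real N * (\<Sum>x=1..N. f (real x / real N) * v N x)) \<longlonglongrightarrow> integral {0..1} (\<lambda>y. p y t * f y)"
    using lim(1,2) by (simp_all only: mult.commute[of "u _ _"] mult.commute[of "v _ _"])
  ultimately show ?thesis by simp
qed

end
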